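(* The downlink and uplink capacities ${\tt C}^{\mathrm{DL}}$ and ${\tt C}^{\mathrm{UL}}$ (defined in the context) are bounded as $${\tt C}^{\mathrm{DL}}\le{\tt C}^{\mathrm{DL}}_{\mathrm{upper}}=\frac{T^{\mathrm{DL}}_{\mathrm{data}}}{T_{\mathrm{coher}}}\log_2\left(1+\frac{G^{\mathrm{DL}}}{1+\kappa_r^{\mathrm{UE}}G^{\mathrm{DL}}}\right),$$ $${\tt C}^{\mathrm{UL}}\le{\tt C}^{\mathrm{UL}}_{\mathrm{upper}}=\frac{T^{\mathrm{UL}}_{\mathrm{data}}}{T_{\mathrm{coher}}}\log_2\left(1+\frac{G^{\mathrm{UL}}}{1+\kappa_t^{\mathrm{UE}}G^{\mathrm{UL}}}\right),$$ where $r_{11},\dots,r_{NN}$ are the diagonal elements of $\mathbf R$, $$G^{\mathrm{DL}}=\sum_{i=1}^N\frac{1}{\kappa_t^{\mathrm{BS}}}\left(1-\frac{\sigma_{\mathrm{UE}}^2}{p^{\mathrm{BS}}\kappa_t^{\mathrm{BS}}r_{ii}}\,e^{\frac{\sigma_{\mathrm{UE}}^2}{p^{\mathrm{BS}}\kappa_t^{\mathrm{BS}}r_{ii}}}E_1\!\left(\frac{\sigma_{\mathrm{UE}}^2}{p^{\mathrm{BS}}\kappa_t^{\mathrm{BS}}r_{ii}}\right)\right),$$ $$G^{\mathrm{UL}}=\sum_{i=1}^N\frac{1}{\kappa_r^{\mathrm{BS}}}\left(1-\frac{\sigma_{\mathrm{BS}}^2}{p^{\mathrm{UE}}\kappa_r^{\mathrm{BS}}r_{ii}}\,e^{\frac{\sigma_{\mathrm{BS}}^2}{p^{\mathrm{UE}}\kappa_r^{\mathrm{BS}}r_{ii}}}E_1\!\left(\frac{\sigma_{\mathrm{BS}}^2}{p^{\mathrm{UE}}\kappa_r^{\mathrm{BS}}r_{ii}}\right)\right),$$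 and $E_1(x)=\int_1^\infty\frac{e^{-tx}}{t}\,dt$ denotes the exponential integral.
   Context: An $N$-antenna base station (BS) and a single-antenna user (UE) share a reciprocal block-fading channel $\mathbf h=[h_1\dots h_N]^T\sim\mathcal{CN}(\mathbf 0,\mathbf R)$, constant in each coherence period of $T_{\mathrm{coher}}$ channel uses and independent between periods; $\mathbf R$ is positive semi-definite with strictly positive diagonal. Of each period, $T^{\mathrm{DL}}_{\mathrm{data}}$ (resp. $T^{\mathrm{UL}}_{\mathrm{data}}$) channel uses carry downlink (resp. uplink) data. $\mathcal H$ is the set of realizations of all useful and interfering channels ($\mathbf h\in\mathcal H$). Downlink: $y=\mathbf h^T(\mathbf s+\boldsymbol\eta_t^{\mathrm{BS}})+\eta_r^{\mathrm{UE}}+n$, with zero-mean data signal $\mathbf s$, $\mathbf W=\mathbb E\{\mathbf s\mathbf s^H\}$ (which may depend on channel knowledge), $p^{\mathrm{BS}}=\mathrm{tr}(\mathbf W)$; given $\mathcal H$, $\boldsymbol\eta_t^{\mathrm{BS}}\sim\mathcal{CN}(\mathbf 0,\kappa_t^{\mathrm{BS}}\mathrm{diag}(W_{11},\dots,W_{NN}))$ and $\eta_r^{\mathrm{UE}}\sim\mathcal{CN}(0,\kappa_r^{\mathrm{UE}}\mathbf h^T\mathbf W\mathbf h^* )$ are independent of each other and of $\mathbf s$; $n=n_{\mathrm{noise}}+n_{\mathrm{interf}}$ with independent noise $n_{\mathrm{noise}}\sim\mathcal{CN}(0,\sigma_{\mathrm{UE}}^2)$ and zero-mean interference independent of the data signal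 with conditional variance $I_{\mathcal H}^{\mathrm{UE}}\ge0$ given $\mathcal H$. Uplink: $\mathbf z=\mathbf h(d+\eta_t^{\mathrm{UE}})+\boldsymbol\eta_r^{\mathrm{BS}}+\boldsymbol\nu$, with data signal $d$ of power $p^{\mathrm{UE}}$; given $\mathcal H$, $\eta_t^{\mathrm{UE}}\sim\mathcal{CN}(0,\kappa_t^{\mathrm{UE}}p^{\mathrm{UE}})$ and $\boldsymbol\eta_r^{\mathrm{BS}}\sim\mathcal{CN}(\mathbf 0,\kappa_r^{\mathrm{BS}}p^{\mathrm{UE}}\mathrm{diag}(|h_1|^2,\dots,|h_N|^2))$ are independent of each other and of $d$; $\boldsymbol\nu$ is the sum of independent noise $\mathcal{CN}(\mathbf 0,\sigma_{\mathrm{BS}}^2\mathbf I)$ and zero-mean interference independent of $d$ with conditional covariance $\mathbf Q_{\mathcal H}$ given $\mathcal H$. Distortion noises are temporally independent. The impairment levels satisfy $\kappa_r^{\mathrm{UE}},\kappa_t^{\mathrm{UE}}\ge0$, $\kappa_t^{\mathrm{BS}},\kappa_r^{\mathrm{BS}}>0$; noise variances are positive. Capacities: with $\mathcal H^{\mathrm{BS}},\mathcal H^{\mathrm{UE}}$ the (arbitrary, imperfect) knowledge of $\mathcal H$ at the BS and UE, $${\tt C}^{\mathrm{DL}}=\frac{T^{\mathrm{DL}}_{\mathrm{data}}}{T_{\mathrm{coher}}}\mathbb E\Big\{\max_{f(\mathbf s|\mathcal H^{\mathrm{BS}}):\,\mathbb E\{\|\mathbf s\|_2^2\}\le p^{\mathrm{BS}}}\mathcal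 I(\mathbf s;y|\mathcal H,\mathcal H^{\mathrm{BS}},\mathcal H^{\mathrm{UE}})\Big\},$$ $${\tt C}^{\mathrm{UL}}=\frac{T^{\mathrm{UL}}_{\mathrm{data}}}{T_{\mathrm{coher}}}\mathbb E\Big\{\max_{f(d|\mathcal H^{\mathrm{UE}}):\,\mathbb E\{|d|^2\}\le p^{\mathrm{UE}}}\mathcal I(d;\mathbf z|\mathcal H,\mathcal H^{\mathrm{BS}},\mathcal H^{\mathrm{UE}})\Big\},$$ where $f(\cdot|\cdot)$ is the conditional distribution of the data signal, $\mathcal I$ is the conditional mutual information (in bits) for the given realizations, and the outer expectations are over the joint distribution of $\mathcal H,\mathcal H^{\mathrm{BS}},\mathcal H^{\mathrm{UE}}$.
   Formalization: The interference is assumed independent, given the channel realizations and knowledge, of the hardware distortion noises as well as of the data signal; otherwise interference could cancel the distortion (e.g. −(hη_t+η_r) in the uplink) and the bound would fail. *)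

theory Defs
  imports "HOL-Probability.Probability"
begin

section \<open>Circularly-symmetric complex Gaussian laws\<close>

text \<open>The scalar law CN(0, v), as a measure on the complex plane. The variance v is the mean of
  the squared modulus, so real and imaginary part each have variance v / 2.\<close>

definition cnormal :: "real \<Rightarrow> complex measure" where
  "cnormal v = (if v = 0 then return borel 0
     else density lborel (\<lambda>z. ennreal (exp (- (cmod z)\<^sup>2 / v) / (pi * v))))"

text \<open>The law CN(0, diag(v)): jointly circularly-symmetric Gaussian components that are
  uncorrelated are independent, hence the product measure.\<close>

definition cnormal_diag :: "('n \<Rightarrow> real) \<Rightarrow> (complex ^ 'n::finite) measure" where
  "cnormal_diag v = distr (\<Pi>\<^sub>M i\<in>UNIV. cnormal (v i)) borel (\<lambda>x. \<chi> i. x i)"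

definition quadratic_form :: "complex ^ 'n ^ 'n \<Rightarrow> complex ^ 'n::finite \<Rightarrow> complex" where
  "quadratic_form R c = (\<Sum>i\<in>UNIV. \<Sum>j\<in>UNIV. cnj (c $ i) * R $ i $ j * c $ j)"

definition hermitian_psd :: "complex ^ 'n ^ 'n::finite \<Rightarrow> bool" where
  "hermitian_psd R \<longleftrightarrow>
     (\<forall>i j. R $ j $ i = cnj (R $ i $ j)) \<and> (\<forall>c. 0 \<le> Re (quadratic_form R c))"

text \<open>The law is CN(0, R) for a possibly singular covariance matrix R, for which there may be no
  density: every linear functional \<open>c\<^sup>H x\<close> is CN(0, \<open>c\<^sup>H R c\<close>).\<close>

definition is_cnormal :: "(complex ^ 'n::finite) measure \<Rightarrow> complex ^ 'n ^ 'n \<Rightarrow> bool" where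
  "is_cnormal \<mu> R \<longleftrightarrow> sets \<mu> = sets borel \<and>
     (\<forall>c. distr \<mu> borel (\<lambda>x. \<Sum>i\<in>UNIV. cnj (c $ i) * x $ i)
        = cnormal (Re (quadratic_form R c)))"


section \<open>Mutual information for one realization of the channels and of the channel knowledge\<close>

text \<open>\<open>\<E>{s s\<^sup>H}\<close> for a signal with law f.\<close>

definition signal_corr :: "(complex ^ 'n::finite) measure \<Rightarrow> complex ^ 'n ^ 'n" where
  "signal_corr f = (\<chi> i j. \<integral>s. s $ i * cnj (s $ j) \<partial>f)"

text \<open>Downlink. The arguments are the impairment levels, the noise variance, the law J of the
  interference, the channel h, and the law f of the data signal; the components of the product
  measure are the data signal, the transmitter distortion, the receiver distortion, the receiver
  noise and the interference. All quantities are conditional laws for the given realization.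

  The product measure makes the five components mutually independent. The library's
  \<open>mutual_information\<close> is real valued, with a default value for an infinite divergence; this
  default plays no role here, because for a positive noise variance and a data signal with finite
  second moment the joint law of input and output is absolutely continuous with respect to the
  product of the marginals and the divergence is finite. The same applies to the uplink.\<close>

definition dl_joint ::
  "real \<Rightarrow> real \<Rightarrow> real \<Rightarrow> complex measure \<Rightarrow> complex ^ 'n::finite \<Rightarrow> (complex ^ 'n) measure \<Rightarrow>
   ((complex ^ 'n) \<times> (complex ^ 'n) \<times> complex \<times> complex \<times> complex) measure" where
  "dl_joint \<kappa>tBS \<kappa>rUE \<sigma>2 J h f =
     (let W = signal_corr f in
      f \<Otimes>\<^sub>M cnormal_diag (\<lambda>i. \<kappa>tBS * Re (W $ i $ i))
        \<Otimes>\<^sub>M cnormal (\<kappa>rUE * Re (\<Sum>i\<in>UNIV. \<Sum>j\<in>UNIV. h $ i * W $ i $ j * cnj (h $ j)))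
        \<Otimes>\<^sub>M cnormal \<sigma>2
        \<Otimes>\<^sub>M J)"

definition dl_mutual_information ::
  "real \<Rightarrow> real \<Rightarrow> real \<Rightarrow> complex measure \<Rightarrow> complex ^ 'n::finite \<Rightarrow> (complex ^ 'n) measure \<Rightarrow> real"
  where
  "dl_mutual_information \<kappa>tBS \<kappa>rUE \<sigma>2 J h f =
     prob_space.mutual_information (dl_joint \<kappa>tBS \<kappa>rUE \<sigma>2 J h f) 2 borel borel
       (\<lambda>(s, \<eta>t, \<eta>r, noise, interf). s)
       (\<lambda>(s, \<eta>t, \<eta>r, noise, interf).
          (\<Sum>i\<in>UNIV. h $ i * (s $ i + \<eta>t $ i)) + \<eta>r + (noise + interf))"

text \<open>Uplink, with p the power that enters the distortion variances.\<close>

definition ul_joint ::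
  "real \<Rightarrow> real \<Rightarrow> real \<Rightarrow> real \<Rightarrow> (complex ^ 'n::finite) measure \<Rightarrow> complex ^ 'n \<Rightarrow> complex measure \<Rightarrow>
   (complex \<times> complex \<times> (complex ^ 'n) \<times> (complex ^ 'n) \<times> (complex ^ 'n)) measure" where
  "ul_joint \<kappa>tUE \<kappa>rBS \<sigma>2 p J h f =
     (f \<Otimes>\<^sub>M cnormal (\<kappa>tUE * p)
        \<Otimes>\<^sub>M cnormal_diag (\<lambda>i. \<kappa>rBS * p * (cmod (h $ i))\<^sup>2)
        \<Otimes>\<^sub>M cnormal_diag (\<lambda>i. \<sigma>2)
        \<Otimes>\<^sub>M J)"

definition ul_mutual_information ::
  "real \<Rightarrow> real \<Rightarrow> real \<Rightarrow> real \<Rightarrow> (complex ^ 'n::finite) measure \<Rightarrow> complex ^ 'n \<Rightarrow> complex measure \<Rightarrow>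
   real" where
  "ul_mutual_information \<kappa>tUE \<kappa>rBS \<sigma>2 p J h f =
     prob_space.mutual_information (ul_joint \<kappa>tUE \<kappa>rBS \<sigma>2 p J h f) 2 borel borel
       (\<lambda>(d, \<eta>t, \<eta>r, noise, interf). d)
       (\<lambda>(d, \<eta>t, \<eta>r, noise, interf). (d + \<eta>t) *s h + \<eta>r + (noise + interf))"


section \<open>Capacities\<close>

text \<open>Conditional distributions of the data signal given the knowledge of the transmitter, which
  takes values in the measurable space B (base station) or C (user). The power constraint is on the
  conditional second moment, for every realization of that knowledge.\<close>

definition dl_inputs :: "'b measure \<Rightarrow> real \<Rightarrow> ('b \<Rightarrow> (complex ^ 'n::finite) measure) set" where
  "dl_inputs B p = {f \<in> B \<rightarrow>\<^sub>M prob_algebra borel.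
     \<forall>b\<in>space B. (\<integral>\<^sup>+ s. ennreal ((norm s)\<^sup>2) \<partial>f b) \<le> ennreal p \<and> (\<integral>s. s \<partial>f b) = 0}"

definition ul_inputs :: "'c measure \<Rightarrow> real \<Rightarrow> ('c \<Rightarrow> complex measure) set" where
  "ul_inputs C p = {f \<in> C \<rightarrow>\<^sub>M prob_algebra borel.
     \<forall>c\<in>space C. (\<integral>\<^sup>+ d. ennreal ((cmod d)\<^sup>2) \<partial>f c) \<le> ennreal p}"

text \<open>In the capacities, H, K and L are the random elements on the probability space M giving the
  realizations of all channels, of the knowledge at the base station and of the knowledge at the
  user; \<open>chan\<close> extracts the useful channel from the collection of all channels, and J is the
  conditional law of the interference. The maximum over the input distributions need not be
  attained, hence the supremum; it is taken inside the expectation.\<close>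

definition dl_capacity ::
  "nat \<Rightarrow> nat \<Rightarrow> 'w measure \<Rightarrow> 'b measure \<Rightarrow> ('w \<Rightarrow> 'a) \<Rightarrow> ('w \<Rightarrow> 'b) \<Rightarrow> ('w \<Rightarrow> 'c) \<Rightarrow>
   ('a \<Rightarrow> complex ^ 'n::finite) \<Rightarrow> ('a \<times> 'b \<times> 'c \<Rightarrow> complex measure) \<Rightarrow>
   real \<Rightarrow> real \<Rightarrow> real \<Rightarrow> real \<Rightarrow> ennreal" where
  "dl_capacity Tdata Tcoher M B H K L chan J \<kappa>tBS \<kappa>rUE \<sigma>2 p =
     ennreal (real Tdata / real Tcoher) *
     (\<integral>\<^sup>+ \<omega>. (SUP f\<in>dl_inputs B p.
        ennreal (dl_mutual_information \<kappa>tBS \<kappa>rUE \<sigma>2 (J (H \<omega>, K \<omega>, L \<omega>)) (chan (H \<omega>)) (f (K \<omega>)))) \<partial>M)"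

definition ul_capacity ::
  "nat \<Rightarrow> nat \<Rightarrow> 'w measure \<Rightarrow> 'c measure \<Rightarrow> ('w \<Rightarrow> 'a) \<Rightarrow> ('w \<Rightarrow> 'b) \<Rightarrow> ('w \<Rightarrow> 'c) \<Rightarrow>
   ('a \<Rightarrow> complex ^ 'n::finite) \<Rightarrow> ('a \<times> 'b \<times> 'c \<Rightarrow> (complex ^ 'n) measure) \<Rightarrow>
   real \<Rightarrow> real \<Rightarrow> real \<Rightarrow> real \<Rightarrow> ennreal" where
  "ul_capacity Tdata Tcoher M C H K L chan J \<kappa>tUE \<kappa>rBS \<sigma>2 p =
     ennreal (real Tdata / real Tcoher) *
     (\<integral>\<^sup>+ \<omega>. (SUP f\<in>ul_inputs C p.
        ennreal (ul_mutual_information \<kappa>tUE \<kappa>rBS \<sigma>2 p (J (H \<omega>, K \<omega>, L \<omega>)) (chan (H \<omega>)) (f (L \<omega>)))) \<partial>M)"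


section \<open>The closed-form bounds\<close>

definition E1 :: "real \<Rightarrow> real" where
  "E1 x = (LINT t:{1..}|lborel. exp (- t * x) / t)"

text \<open>\<open>G\<^sup>D\<^sup>L\<close> and \<open>G\<^sup>U\<^sup>L\<close> are the same function, of the impairment level at the base
  station, the noise variance, the transmit power and the covariance matrix.\<close>

definition G_bound :: "real \<Rightarrow> real \<Rightarrow> real \<Rightarrow> complex ^ 'n ^ 'n::finite \<Rightarrow> real" where
  "G_bound \<kappa> \<sigma>2 p R =
     (\<Sum>i\<in>UNIV. let x = \<sigma>2 / (p * \<kappa> * Re (R $ i $ i)) in 1 / \<kappa> * (1 - x * exp x * E1 x))"

definition capacity_upper :: "nat \<Rightarrow> nat \<Rightarrow> real \<Rightarrow> real \<Rightarrow> real" where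
  "capacity_upper Tdata Tcoher \<kappa>UE G =
     real Tdata / real Tcoher * log 2 (1 + G / (1 + \<kappa>UE * G))"

end

theory Submission
  imports Defs
begin

text \<open>Fix a realization. If the pair of the input X and a variable Z has density a with respect to
  the product of the law of X and some probability measure, then the mutual information of X and any
  function of Z is at most \<open>\<E>{log a(X, Z)}\<close>. Taking Z to be the pair of a scalar Gaussian channel output
  and an independent variable W gives \<open>log(1 + P / N)\<close> for everything computed from that output and W,
  whatever the law of the input.

  In the downlink, W is the interference. In the uplink, the noise plus distortion vector is split
  into an independent scalar Gaussian multiple of the channel vector and a remainder, and the
  remainder is moved to W together with the interference; this replaces the inversion of a covariance
  matrix. In both cases \<open>P / N\<close> is at most \<open>g / (1 + \<kappa> g)\<close> with the gain
  \<open>g = \<Sum>i. |h\<^sub>i|\<^sup>2 / (\<kappa>\<^sup>B\<^sup>S |h\<^sub>i|\<^sup>2 + \<sigma>\<^sup>2 / p)\<close>; in the downlink this is the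
  Cauchy-Schwarz inequality. Jensen's inequality and \<open>\<E>{g} = G\<close> finish the proof.\<close>

section \<open>Bounding mutual information by a change of reference measure\<close>

text \<open>The argument that a Gaussian maximizes entropy is replaced by Gibbs' inequality: the
  mutual information is at most the mean log-likelihood ratio against a reference output law. The
  reference chosen is the output law that a Gaussian input of the same power would produce; then
  only the second moment of the input enters the mean. Processing of Z by F is built into the same
  inequality, so the interference can be handed over as side information. When a channel is
  rewritten, the joint law of input and output has to be preserved, and for this reason the
  rewriting is done under integrals of functions of both. Zero impairment levels and zero channel
  coefficients make some Gaussian laws point masses; they are always combined with a Gaussian of
  positive variance. Jensen's inequality takes the form of a tangent line at G, so that only the
  mean of the gain has to be computed.\<close>

lemma (in information_space) mutual_information_le_expectation_log:
  fixes a :: "'b \<times> 'c \<Rightarrow> real"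
  assumes X [measurable]: "X \<in> M \<rightarrow>\<^sub>M S" and Z [measurable]: "Z \<in> M \<rightarrow>\<^sub>M U" and F [measurable]: "F \<in> U \<rightarrow>\<^sub>M T"
    and \<nu>: "prob_space \<nu>" and sets_\<nu> [measurable_cong]: "sets \<nu> = sets U"
    and a [measurable]: "a \<in> borel_measurable (S \<Otimes>\<^sub>M U)" and a_pos: "\<And>p. 0 < a p"
    and law: "distr M (S \<Otimes>\<^sub>M U) (\<lambda>\<omega>. (X \<omega>, Z \<omega>)) = density (distr M S X \<Otimes>\<^sub>M \<nu>) (\<lambda>p. ennreal (a p))"
    and int: "integrable M (\<lambda>\<omega>. log b (a (X \<omega>, Z \<omega>)))"
    and le: "(\<integral>\<omega>. log b (a (X \<omega>, Z \<omega>)) \<partial>M) \<le> c" and "0 \<le> c"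
  shows "mutual_information b S T X (\<lambda>\<omega>. F (Z \<omega>)) \<le> c"
proof -
  define PX where "PX = distr M S X"
  define PZ where "PZ = distr M U Z"
  define PY where "PY = distr M T (\<lambda>\<omega>. F (Z \<omega>))"
  define Q where "Q = distr M (S \<Otimes>\<^sub>M T) (\<lambda>\<omega>. (X \<omega>, F (Z \<omega>)))"
  define \<nu>Y where "\<nu>Y = distr \<nu> T F"
  have [measurable_cong]: "sets PX = sets S" "sets PZ = sets U" "sets PY = sets T" "sets \<nu>Y = sets T"
     "sets Q = sets (S \<Otimes>\<^sub>M T)"
    by (simp_all add: PX_def PZ_def PY_def \<nu>Y_def Q_def)
  have sets_PXY: "sets (PX \<Otimes>\<^sub>M PY) = sets (S \<Otimes>\<^sub>M T)"
    by (rule sets_pair_measure_cong) (simp_all add: PX_def PY_def)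
  have space_\<nu>: "space \<nu> = space U" using sets_\<nu> by (rule sets_eq_imp_space_eq)
  interpret \<nu>: prob_space \<nu> by fact
  interpret PX: prob_space PX unfolding PX_def by (rule prob_space_distr) simp
  interpret PY: prob_space PY unfolding PY_def by (rule prob_space_distr) simp
  interpret PZ: prob_space PZ unfolding PZ_def by (rule prob_space_distr) simp
  interpret \<nu>Y: prob_space \<nu>Y unfolding \<nu>Y_def by (rule \<nu>.prob_space_distr) simp
  interpret Q: prob_space Q unfolding Q_def by (rule prob_space_distr) simp
  interpret PXY: pair_prob_space PX PY ..
  interpret PX\<nu>: pair_prob_space PX \<nu> ..
  interpret PX\<nu>Y: pair_prob_space PX \<nu>Y ..
  have law_nn: "(\<integral>\<^sup>+\<omega>. G (X \<omega>, Z \<omega>) \<partial>M) = (\<integral>\<^sup>+p. ennreal (a p) * G p \<partial>(PX \<Otimes>\<^sub>M \<nu>))"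
    if [measurable]: "G \<in> borel_measurable (S \<Otimes>\<^sub>M U)" for G
  proof -
    have "(\<integral>\<^sup>+\<omega>. G (X \<omega>, Z \<omega>) \<partial>M) = (\<integral>\<^sup>+p. G p \<partial>distr M (S \<Otimes>\<^sub>M U) (\<lambda>\<omega>. (X \<omega>, Z \<omega>)))"
      by (simp add: nn_integral_distr)
    also have "\<dots> = (\<integral>\<^sup>+p. ennreal (a p) * G p \<partial>(PX \<Otimes>\<^sub>M \<nu>))"
      unfolding law PX_def[symmetric] by (subst nn_integral_density) simp_all
    finally show ?thesis .
  qed
  \<comment> \<open>\<open>\<alpha>\<close> is the density of the law of Z with respect to
    \<open>\<nu>\<close>. Since \<open>a\<close> is strictly positive, \<open>\<alpha>\<close>
    vanishes nowhere and both measures have the same null sets. Almost-sure statements can then be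
    carried from the actual output law to the reference law, the direction that a density alone does
    not give.\<close>
  define \<alpha> where "\<alpha> z = (\<integral>\<^sup>+x. ennreal (a (x, z)) \<partial>PX)" for z
  have [measurable]: "\<alpha> \<in> borel_measurable U" unfolding \<alpha>_def by measurable
  have \<alpha>_pos: "\<alpha> z \<noteq> 0" if z: "z \<in> space U" for z
  proof
    assume "\<alpha> z = 0"
    then have "AE x in PX. ennreal (a (x, z)) = 0"
      unfolding \<alpha>_def using z by (subst (asm) nn_integral_0_iff_AE) simp_all
    then have "AE x in PX. False" using a_pos by (auto elim!: AE_mp simp: ennreal_eq_0_iff not_le less_imp_neq not_less[symmetric])
    then show False by simp
  qed
  have PZ_eq: "PZ = density \<nu> \<alpha>"
  proof (rule measure_eqI)
    fix A assume "A \<in> sets PZ"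
    then have A[measurable]: "A \<in> sets U" by (simp add: PZ_def)
    have "emeasure PZ A = (\<integral>\<^sup>+z. indicator A z \<partial>PZ)" by simp
    also have "\<dots> = (\<integral>\<^sup>+\<omega>. indicator A (Z \<omega>) \<partial>M)"
      unfolding PZ_def by (subst nn_integral_distr) simp_all
    also have "\<dots> = (\<integral>\<^sup>+p. ennreal (a p) * indicator A (snd p) \<partial>(PX \<Otimes>\<^sub>M \<nu>))"
      using law_nn[of "\<lambda>p. indicator A (snd p)"] by simp
    also have "\<dots> = (\<integral>\<^sup>+z. \<integral>\<^sup>+x. ennreal (a (x, z)) * indicator A z \<partial>PX \<partial>\<nu>)"
      by (subst PX\<nu>.nn_integral_snd[symmetric]) (simp_all add: split_beta')
    also have "\<dots> = (\<integral>\<^sup>+z. \<alpha> z * indicator A z \<partial>\<nu>)"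
      unfolding \<alpha>_def by (intro nn_integral_cong nn_integral_multc) (simp add: space_\<nu>)
    finally show "emeasure PZ A = emeasure (density \<nu> \<alpha>) A"
      by (simp add: emeasure_density)
  qed (simp add: PZ_def sets_\<nu>)
  have AE_PZ: "AE z in \<nu>. P z" if "AE z in PZ. P z" and [measurable]: "Measurable.pred U P" for P
    using that(1) \<alpha>_pos unfolding PZ_eq
    by (subst (asm) AE_density) (auto elim!: AE_mp simp: sets_eq_imp_space_eq[OF sets_\<nu>] zero_less_iff_neq_zero)
  have AE_PY: "AE y in \<nu>Y. P y" if "AE y in PY. P y" and [measurable]: "Measurable.pred T P" for P
  proof -
    have "AE \<omega> in M. P (F (Z \<omega>))"
      using that(1) unfolding PY_def by (subst (asm) AE_distr_iff) simp_all
    then have "AE z in PZ. P (F z)"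
      unfolding PZ_def by (subst AE_distr_iff) simp_all
    from AE_PZ[OF this] show ?thesis unfolding \<nu>Y_def by (subst AE_distr_iff) simp_all
  qed
  \<comment> \<open>A null set of the product of the marginals has \<open>PX\<close>-null fibres
    over \<open>PY\<close>-almost all y, hence over \<open>\<nu>Y\<close>-almost all y. Its preimage
    under F is then null for the product of \<open>PX\<close> and \<open>\<nu>\<close>, and
    \<open>law\<close> makes it null for \<open>Q\<close>. So the Radon-Nikodym derivative below is
    a true density.\<close>
  have QP: "absolutely_continuous (PX \<Otimes>\<^sub>M PY) Q"
    unfolding absolutely_continuous_def
  proof
    fix A assume "A \<in> null_sets (PX \<Otimes>\<^sub>M PY)"
    then have A[measurable]: "A \<in> sets (S \<Otimes>\<^sub>M T)" and A0: "emeasure (PX \<Otimes>\<^sub>M PY) A = 0"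
      by (auto simp: null_sets_def sets_PXY)
    have "(\<integral>\<^sup>+y. \<integral>\<^sup>+x. indicator A (x, y) \<partial>PX \<partial>PY) = 0"
      using A0 by (subst PXY.nn_integral_snd) simp_all
    then have "AE y in PY. (\<integral>\<^sup>+x. indicator A (x, y) \<partial>PX) = 0"
      by (subst (asm) nn_integral_0_iff_AE) simp_all
    from AE_PY[OF this] have "AE y in \<nu>Y. (\<integral>\<^sup>+x. indicator A (x, y) \<partial>PX) = 0" by simp
    then have "AE z in \<nu>. (\<integral>\<^sup>+x. indicator A (x, F z) \<partial>PX) = 0"
      unfolding \<nu>Y_def by (subst (asm) AE_distr_iff) simp_all
    then have "(\<integral>\<^sup>+z. \<integral>\<^sup>+x. indicator A (x, F z) \<partial>PX \<partial>\<nu>) = 0"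
      by (subst nn_integral_0_iff_AE) simp_all
    then have "(\<integral>\<^sup>+p. indicator A (fst p, F (snd p)) \<partial>(PX \<Otimes>\<^sub>M \<nu>)) = 0"
      by (subst PX\<nu>.nn_integral_snd[symmetric]) (simp_all add: split_beta')
    then have "AE p in PX \<Otimes>\<^sub>M \<nu>. indicator A (fst p, F (snd p)) = (0::ennreal)"
      by (subst (asm) nn_integral_0_iff_AE) simp_all
    then have "(\<integral>\<^sup>+p. ennreal (a p) * indicator A (fst p, F (snd p)) \<partial>(PX \<Otimes>\<^sub>M \<nu>)) = 0"
      by (subst nn_integral_0_iff_AE) auto
    then have "(\<integral>\<^sup>+\<omega>. indicator A (X \<omega>, F (Z \<omega>)) \<partial>M) = 0"
      using law_nn[of "\<lambda>p. indicator A (fst p, F (snd p))"] by simp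
    then have "emeasure Q A = 0"
      unfolding Q_def by (subst nn_integral_indicator[symmetric], simp, subst nn_integral_distr) simp_all
    then show "A \<in> null_sets Q" by (auto simp: Q_def)
  qed
  have sets_Q: "sets Q = sets (PX \<Otimes>\<^sub>M PY)" by (simp add: Q_def sets_PXY)
  obtain D where D_m: "D \<in> borel_measurable (PX \<Otimes>\<^sub>M PY)"
    and D: "AE x in PX \<Otimes>\<^sub>M PY. RN_deriv (PX \<Otimes>\<^sub>M PY) Q x = ennreal (D x)"
    and D_pos: "AE x in Q. 0 < D x" and D_nn: "\<And>x. 0 \<le> D x"
    by (rule PXY.P.real_RN_deriv[OF Q.finite_measure_axioms QP sets_Q]) (rule that; assumption)
  have [measurable]: "D \<in> borel_measurable (S \<Otimes>\<^sub>M T)"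
    using D_m by (simp only: measurable_cong_sets[OF sets_PXY refl])
  have "Q = density (PX \<Otimes>\<^sub>M PY) (RN_deriv (PX \<Otimes>\<^sub>M PY) Q)"
    by (rule PXY.P.density_RN_deriv[OF QP sets_Q, symmetric])
  also have "\<dots> = density (PX \<Otimes>\<^sub>M PY) (\<lambda>x. ennreal (D x))"
    by (rule density_cong) (use D D_m in auto)
  finally have Q_eq: "Q = density (PX \<Otimes>\<^sub>M PY) (\<lambda>x. ennreal (D x))" .
  have MI: "mutual_information b S T X (\<lambda>\<omega>. F (Z \<omega>)) = (\<integral>\<omega>. log b (D (X \<omega>, F (Z \<omega>))) \<partial>M)"
  proof -
    have "mutual_information b S T X (\<lambda>\<omega>. F (Z \<omega>)) = KL_divergence b (PX \<Otimes>\<^sub>M PY) Q"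
      by (simp add: mutual_information_def PX_def PY_def Q_def)
    also have "\<dots> = (\<integral>x. D x * log b (D x) \<partial>(PX \<Otimes>\<^sub>M PY))"
      unfolding Q_eq by (rule PXY.P.KL_density) (use b_gt_1 D_nn in auto)
    also have "\<dots> = (\<integral>x. log b (D x) \<partial>Q)"
      unfolding Q_eq by (subst integral_real_density) (use D_nn in auto)
    also have "\<dots> = (\<integral>\<omega>. log b (D (X \<omega>, F (Z \<omega>))) \<partial>M)"
      unfolding Q_def by (subst integral_distr) simp_all
    finally show ?thesis .
  qed
  \<comment> \<open>The second marginal of \<open>Q\<close> is \<open>PY\<close>, so
    \<open>D\<close> integrates to 1 along almost every fibre. Once moved to \<open>\<nu>Y\<close>,
    these fibre integrals are all that the reference law sees of \<open>D\<close>.\<close>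
  have D1: "AE y in PY. (\<integral>\<^sup>+x. ennreal (D (x, y)) \<partial>PX) = 1"
  proof -
    have "density PY (\<lambda>y. \<integral>\<^sup>+x. ennreal (D (x, y)) \<partial>PX) = density PY (\<lambda>_. 1)"
    proof (rule measure_eqI)
      fix B assume "B \<in> sets (density PY (\<lambda>y. \<integral>\<^sup>+x. ennreal (D (x, y)) \<partial>PX))"
      then have B[measurable]: "B \<in> sets T" by (simp add: PY_def)
      have "emeasure (density PY (\<lambda>y. \<integral>\<^sup>+x. ennreal (D (x, y)) \<partial>PX)) B
        = (\<integral>\<^sup>+y. (\<integral>\<^sup>+x. ennreal (D (x, y)) \<partial>PX) * indicator B y \<partial>PY)"
        by (simp add: emeasure_density)
      also have "\<dots> = (\<integral>\<^sup>+y. \<integral>\<^sup>+x. ennreal (D (x, y)) * indicator B y \<partial>PX \<partial>PY)"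
        by (intro nn_integral_cong nn_integral_multc[symmetric]) (simp add: PY_def)
      also have "\<dots> = (\<integral>\<^sup>+p. ennreal (D p) * indicator B (snd p) \<partial>(PX \<Otimes>\<^sub>M PY))"
        by (subst PXY.nn_integral_snd[symmetric]) (simp_all add: split_beta')
      also have "\<dots> = (\<integral>\<^sup>+p. indicator B (snd p) \<partial>Q)"
        unfolding Q_eq by (subst nn_integral_density) simp_all
      also have "\<dots> = (\<integral>\<^sup>+y. indicator B y \<partial>PY)"
        unfolding Q_def PY_def by (simp add: nn_integral_distr del: nn_integral_indicator)
      finally show "emeasure (density PY (\<lambda>y. \<integral>\<^sup>+x. ennreal (D (x, y)) \<partial>PX)) B = emeasure (density PY (\<lambda>_. 1)) B"
        by (simp add: emeasure_density)
    qed simp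
    then show ?thesis by (subst (asm) PY.density_unique_iff) simp_all
  qed
  from AE_PY[OF D1] have D1\<nu>: "AE y in \<nu>Y. (\<integral>\<^sup>+x. ennreal (D (x, y)) \<partial>PX) = 1" by simp
  \<comment> \<open>Under the joint law the factor \<open>1 / a\<close> cancels the density
    \<open>a\<close>; what remains is the integral of \<open>D\<close> against \<open>PX\<close> and
    the reference law of \<open>F z\<close>.\<close>
  have EZ: "(\<integral>\<^sup>+\<omega>. ennreal (D (X \<omega>, F (Z \<omega>)) / a (X \<omega>, Z \<omega>)) \<partial>M) = 1"
  proof -
    have "(\<integral>\<^sup>+\<omega>. ennreal (D (X \<omega>, F (Z \<omega>)) / a (X \<omega>, Z \<omega>)) \<partial>M) =
      (\<integral>\<^sup>+p. ennreal (a p) * ennreal (D (fst p, F (snd p)) / a p) \<partial>(PX \<Otimes>\<^sub>M \<nu>))"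
      using law_nn[of "\<lambda>p. ennreal (D (fst p, F (snd p)) / a p)"] by simp
    also have "\<dots> = (\<integral>\<^sup>+p. ennreal (D (fst p, F (snd p))) \<partial>(PX \<Otimes>\<^sub>M \<nu>))"
      using a_pos D_nn by (intro nn_integral_cong) (simp add: ennreal_mult[symmetric] less_imp_le less_imp_neq[THEN not_sym])
    also have "\<dots> = (\<integral>\<^sup>+z. \<integral>\<^sup>+x. ennreal (D (x, F z)) \<partial>PX \<partial>\<nu>)"
      by (subst PX\<nu>.nn_integral_snd[symmetric]) (simp_all add: split_beta')
    also have "\<dots> = (\<integral>\<^sup>+y. \<integral>\<^sup>+x. ennreal (D (x, y)) \<partial>PX \<partial>\<nu>Y)"
      unfolding \<nu>Y_def by (subst nn_integral_distr) simp_all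
    also have "\<dots> = (\<integral>\<^sup>+y. 1 \<partial>\<nu>Y)" by (rule nn_integral_cong_AE) (use D1\<nu> in auto)
    finally show ?thesis by (simp add: \<nu>Y.emeasure_space_1)
  qed
  show ?thesis
  proof (cases "integrable M (\<lambda>\<omega>. log b (D (X \<omega>, F (Z \<omega>))))")
    \<comment> \<open>The Bochner integral of a non-integrable function is 0, so the mutual
      information is 0 here and \<open>0 \<le> c\<close> closes the case.\<close>
    case False
    then show ?thesis using MI \<open>0 \<le> c\<close> by (simp add: not_integrable_integral_eq)
  next
    case True
    have intZ: "integrable M (\<lambda>\<omega>. D (X \<omega>, F (Z \<omega>)) / a (X \<omega>, Z \<omega>))"
      using EZ a_pos D_nn by (intro integrableI_nonneg) (auto intro!: divide_nonneg_nonneg simp: less_imp_le)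
    have EZ': "(\<integral>\<omega>. D (X \<omega>, F (Z \<omega>)) / a (X \<omega>, Z \<omega>) \<partial>M) = 1"
      using EZ a_pos D_nn by (subst integral_eq_nn_integral) (auto intro!: divide_nonneg_nonneg simp: less_imp_le)
    have ae: "AE \<omega> in M. 0 < D (X \<omega>, F (Z \<omega>))"
      using D_pos unfolding Q_def by (subst (asm) AE_distr_iff) simp_all
    have "(\<integral>\<omega>. log b (D (X \<omega>, F (Z \<omega>))) \<partial>M) \<le>
      (\<integral>\<omega>. log b (a (X \<omega>, Z \<omega>)) + (D (X \<omega>, F (Z \<omega>)) / a (X \<omega>, Z \<omega>) - 1) / ln b \<partial>M)"
    proof (rule integral_mono_AE)
      show "AE \<omega> in M. log b (D (X \<omega>, F (Z \<omega>))) \<le> log b (a (X \<omega>, Z \<omega>)) + (D (X \<omega>, F (Z \<omega>)) / a (X \<omega>, Z \<omega>) - 1) / ln b"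
        using ae
      proof eventually_elim
        case (elim \<omega>)
        let ?d = "D (X \<omega>, F (Z \<omega>))" and ?a = "a (X \<omega>, Z \<omega>)"
        \<comment> \<open>Gibbs' inequality: \<open>ln x \<le> x - 1\<close> is applied to
          \<open>?d / ?a\<close>, whose mean is 1 by \<open>EZ'\<close>, so the correction
          integrates to 0.\<close>
        have "ln ?d = ln ?a + ln (?d / ?a)" using elim a_pos[of "(X \<omega>, Z \<omega>)"] by (simp add: ln_div)
        also have "\<dots> \<le> ln ?a + (?d / ?a - 1)" using elim a_pos by (intro add_left_mono ln_le_minus_one) simp
        finally have "ln ?d / ln b \<le> (ln ?a + (?d / ?a - 1)) / ln b"
          using b_gt_1 by (intro divide_right_mono) auto
        then show ?case by (simp add: log_def add_divide_distrib)
      qed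
    qed (use True int intZ in auto)
    also have "\<dots> = (\<integral>\<omega>. log b (a (X \<omega>, Z \<omega>)) \<partial>M)"
      using int intZ EZ' by (simp add: prob_space)
    finally show ?thesis using MI le by simp
  qed
qed

text \<open>Both marginals are images of the joint law. This lets a channel model be exchanged for
  another one on a different probability space.\<close>

lemma mutual_information_cong_joint_law:
  assumes "prob_space M" "prob_space N"
    and X [measurable]: "X \<in> M \<rightarrow>\<^sub>M S" and Y [measurable]: "Y \<in> M \<rightarrow>\<^sub>M T"
    and X' [measurable]: "X' \<in> N \<rightarrow>\<^sub>M S" and Y' [measurable]: "Y' \<in> N \<rightarrow>\<^sub>M T"
    and eq: "distr M (S \<Otimes>\<^sub>M T) (\<lambda>\<omega>. (X \<omega>, Y \<omega>)) = distr N (S \<Otimes>\<^sub>M T) (\<lambda>\<omega>. (X' \<omega>, Y' \<omega>))"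
  shows "prob_space.mutual_information M b S T X Y = prob_space.mutual_information N b S T X' Y'"
proof -
  interpret M: prob_space M by fact
  interpret N: prob_space N by fact
  have "distr (distr M (S \<Otimes>\<^sub>M T) (\<lambda>\<omega>. (X \<omega>, Y \<omega>))) S fst = distr (distr N (S \<Otimes>\<^sub>M T) (\<lambda>\<omega>. (X' \<omega>, Y' \<omega>))) S fst"
    by (simp add: eq)
  then have 1: "distr M S X = distr N S X'" by (simp add: distr_distr comp_def)
  have "distr (distr M (S \<Otimes>\<^sub>M T) (\<lambda>\<omega>. (X \<omega>, Y \<omega>))) T snd = distr (distr N (S \<Otimes>\<^sub>M T) (\<lambda>\<omega>. (X' \<omega>, Y' \<omega>))) T snd"
    by (simp add: eq)
  then have 2: "distr M T Y = distr N T Y'" by (simp add: distr_distr comp_def)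
  show ?thesis unfolding M.mutual_information_def N.mutual_information_def eq 1 2 ..
qed

section \<open>The scalar circularly-symmetric Gaussian law\<close>

definition cnormal_density :: "real \<Rightarrow> complex \<Rightarrow> real" where
  "cnormal_density v z = exp (- (cmod z)\<^sup>2 / v) / (pi * v)"

lemma cnormal_density_pos: "0 < v \<Longrightarrow> 0 < cnormal_density v z"
  by (simp add: cnormal_density_def)

lemma borel_measurable_cnormal_density [measurable]: "cnormal_density v \<in> borel_measurable borel"
  unfolding cnormal_density_def by measurable

lemma cnormal_eq_density: "0 < v \<Longrightarrow> cnormal v = density lborel (\<lambda>z. ennreal (cnormal_density v z))"
  by (simp add: cnormal_def cnormal_density_def)

lemma cnormal_0: "cnormal 0 = return borel 0"
  by (simp add: cnormal_def)

lemma sets_cnormal [simp, measurable_cong]: "sets (cnormal v) = sets borel"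
  by (simp add: cnormal_def)

lemma space_cnormal [simp]: "space (cnormal v) = UNIV"
  by (simp add: cnormal_def)

lemma nn_integral_cnormal:
  "0 < v \<Longrightarrow> f \<in> borel_measurable borel \<Longrightarrow>
    (\<integral>\<^sup>+z. f z \<partial>cnormal v) = (\<integral>\<^sup>+z. ennreal (cnormal_density v z) * f z \<partial>lborel)"
  by (simp add: cnormal_eq_density nn_integral_density)

text \<open>Reduces integrals over the plane to products of real normal integrals.\<close>

lemma cnormal_density_eq_prod:
  assumes "0 < v"
  shows "cnormal_density v z = (\<Prod>b\<in>Basis. normal_density 0 (sqrt (v / 2)) (z \<bullet> b))"
proof -
  have "normal_density 0 (sqrt (v / 2)) x = exp (- x\<^sup>2 / v) / sqrt (pi * v)" for x
    using assms by (simp add: normal_density_def)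
  then have "(\<Prod>b\<in>Basis. normal_density 0 (sqrt (v / 2)) (z \<bullet> b)) =
    (exp (- (Re z)\<^sup>2 / v) * exp (- (Im z)\<^sup>2 / v)) / (sqrt (pi * v) * sqrt (pi * v))"
    by (simp add: Basis_complex_def)
  also have "\<dots> = exp (- (Re z)\<^sup>2 / v + - (Im z)\<^sup>2 / v) / (pi * v)"
    using assms by (simp only: mult_exp_exp real_sqrt_mult_self) simp
  also have "- (Re z)\<^sup>2 / v + - (Im z)\<^sup>2 / v = - (cmod z)\<^sup>2 / v"
    by (simp add: cmod_power2 diff_divide_distrib)
  finally show ?thesis by (simp add: cnormal_density_def)
qed

lemma nn_integral_normal_density:
  "0 < \<sigma> \<Longrightarrow> (\<integral>\<^sup>+x. ennreal (normal_density \<mu> \<sigma> x) \<partial>lborel) = 1"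
  using prob_space.emeasure_space_1[OF prob_space_normal_density[of \<sigma> \<mu>]]
  by (simp add: emeasure_density)

lemma nn_integral_normal_second_moment:
  "0 < \<sigma> \<Longrightarrow> (\<integral>\<^sup>+x. ennreal (normal_density 0 \<sigma> x * x\<^sup>2) \<partial>lborel) = ennreal (\<sigma>\<^sup>2)"
  using normal_moment_even[of \<sigma> 0 1]
  by (subst nn_integral_eq_integral) (auto simp: has_bochner_integral_iff)

lemma nn_integral_cnormal_density:
  assumes "0 < v"
  shows "(\<integral>\<^sup>+z. ennreal (cnormal_density v z) \<partial>lborel) = 1"
proof -
  have "(\<integral>\<^sup>+z. ennreal (cnormal_density v z) \<partial>lborel) =
    (\<integral>\<^sup>+z. (\<Prod>b\<in>Basis. ennreal (normal_density 0 (sqrt (v / 2)) (z \<bullet> b))) \<partial>(lborel :: complex measure))"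
    by (intro nn_integral_cong) (simp add: cnormal_density_eq_prod[OF assms] prod_ennreal)
  also have "\<dots> = (\<Prod>b\<in>(Basis :: complex set). (\<integral>\<^sup>+x. ennreal (normal_density 0 (sqrt (v / 2)) x) \<partial>lborel))"
    by (rule nn_integral_lborel_prod) auto
  also have "\<dots> = 1" using assms by (simp add: nn_integral_normal_density)
  finally show ?thesis .
qed

lemma prob_space_cnormal:
  assumes "0 \<le> v"
  shows "prob_space (cnormal v)"
proof (cases "v = 0")
  case True
  then show ?thesis by (simp add: cnormal_0 prob_space_return)
next
  case False
  then have "0 < v" using assms by simp
  then show ?thesis
    by (intro prob_spaceI) (simp add: cnormal_eq_density emeasure_density nn_integral_cnormal_density)
qed

lemma nn_integral_cnormal_second_moment:
  assumes "0 \<le> v"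
  shows "(\<integral>\<^sup>+z. ennreal ((cmod z)\<^sup>2) \<partial>cnormal v) = ennreal v"
proof (cases "v = 0")
  case True
  then show ?thesis by (simp add: cnormal_0 nn_integral_return)
next
  case False
  then have v: "0 < v" using assms by simp
  let ?\<phi> = "normal_density 0 (sqrt (v / 2))"
  \<comment> \<open>The weight \<open>x\<^sup>2\<close> sits in the coordinate c only, so the
    integrand is still a product over coordinates. The sum over both choices of c gives the squared
    modulus.\<close>
  define F where "F b c x = ennreal (if b = c then ?\<phi> x * x\<^sup>2 else ?\<phi> x)" for b c :: complex and x
  have [measurable]: "F b c \<in> borel_measurable borel" for b c unfolding F_def by (cases "b = c") simp_all
  have F: "(\<integral>\<^sup>+z. (\<Prod>b\<in>Basis. F b c (z \<bullet> b)) \<partial>lborel) = ennreal (v / 2)" if "c \<in> Basis" for c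
  proof -
    have "(\<integral>\<^sup>+z. (\<Prod>b\<in>Basis. F b c (z \<bullet> b)) \<partial>lborel) = (\<Prod>b\<in>Basis. \<integral>\<^sup>+x. F b c x \<partial>lborel)"
      by (rule nn_integral_lborel_prod) auto
    also have "\<dots> = (\<Prod>b\<in>Basis. if b = c then ennreal (v / 2) else 1)"
      unfolding F_def using v
      by (intro prod.cong) (auto simp: nn_integral_normal_density nn_integral_normal_second_moment)
    finally show ?thesis using that by (simp add: prod.delta)
  qed
  have "(\<integral>\<^sup>+z. ennreal ((cmod z)\<^sup>2) \<partial>cnormal v) =
    (\<integral>\<^sup>+z. (\<Prod>b\<in>Basis. F b 1 (z \<bullet> b)) + (\<Prod>b\<in>Basis. F b \<i> (z \<bullet> b)) \<partial>lborel)"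
    using v
    by (simp add: nn_integral_cnormal, intro nn_integral_cong)
       (simp add: cnormal_density_eq_prod F_def Basis_complex_def cmod_power2 ennreal_mult[symmetric]
         ennreal_plus[symmetric] algebra_simps del: ennreal_plus)
  also have "\<dots> = ennreal (v / 2) + ennreal (v / 2)"
    using F[of 1] F[of \<i>] by (subst nn_integral_add) auto
  finally show ?thesis using v by (simp add: ennreal_plus[symmetric] del: ennreal_plus)
qed

lemma nn_integral_lborel_shift:
  fixes c :: "'a::euclidean_space"
  assumes [measurable]: "f \<in> borel_measurable borel"
  shows "(\<integral>\<^sup>+x. f (x + c) \<partial>lborel) = (\<integral>\<^sup>+x. f x \<partial>lborel)"
proof -
  have "(\<integral>\<^sup>+x. f x \<partial>lborel) = (\<integral>\<^sup>+x. f x \<partial>distr lborel borel ((+) c))"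
    by (simp add: lborel_distr_plus)
  then show ?thesis by (simp add: nn_integral_distr add.commute)
qed

lemma distr_cnormal_uminus: "distr (cnormal v) borel uminus = cnormal v"
proof (cases "v = 0")
  case True
  then show ?thesis by (simp add: cnormal_0 distr_return)
next
  case False
  have L: "(lborel :: complex measure) = distr lborel borel uminus"
    using lborel_affine[of "-1" "0::complex"] by (simp add: density_1)
  have "distr (cnormal v) borel uminus = distr (density (distr lborel borel uminus) (cnormal_density v)) borel uminus"
    using False by (subst L[symmetric]) (simp add: cnormal_def cnormal_density_def)
  also have "\<dots> = density lborel (\<lambda>z. ennreal (cnormal_density v z))"
    by (subst density_distr) (simp_all add: distr_distr comp_def cnormal_density_def distr_id2)
  finally show ?thesis using False by (simp add: cnormal_def cnormal_density_def)
qed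

lemma integrable_cnormal_norm2: "0 \<le> v \<Longrightarrow> integrable (cnormal v) (\<lambda>z. (cmod z)\<^sup>2)"
  by (intro integrableI_nonneg) (simp_all add: nn_integral_cnormal_second_moment)

lemma integral_cnormal_norm2: "0 \<le> v \<Longrightarrow> (\<integral>z. (cmod z)\<^sup>2 \<partial>cnormal v) = v"
  by (subst integral_eq_nn_integral) (simp_all add: nn_integral_cnormal_second_moment)

text \<open>Reflection turns the integral into its own negative.\<close>

lemma integral_cnormal_inner: "(\<integral>z. u \<bullet> z \<partial>cnormal v) = 0"
proof -
  have "(\<integral>z. u \<bullet> z \<partial>cnormal v) = (\<integral>z. u \<bullet> z \<partial>distr (cnormal v) borel uminus)"
    by (simp add: distr_cnormal_uminus)
  also have "\<dots> = - (\<integral>z. u \<bullet> z \<partial>cnormal v)"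
    by (subst integral_distr) simp_all
  finally show ?thesis by simp
qed

lemma abs_inner_le_norm2:
  fixes x y :: "'a::real_inner"
  shows "\<bar>x \<bullet> y\<bar> \<le> (norm x)\<^sup>2 + (norm y)\<^sup>2"
proof -
  have "\<bar>x \<bullet> y\<bar> \<le> norm x * norm y" by (rule Cauchy_Schwarz_ineq2)
  also have "\<dots> \<le> (norm x)\<^sup>2 + (norm y)\<^sup>2"
    using zero_le_power2[of "norm x - norm y"] mult_nonneg_nonneg[OF norm_ge_zero[of x] norm_ge_zero[of y]]
    unfolding power2_diff by linarith
  finally show ?thesis .
qed

text \<open>Completing the square. This is Bayes' rule for w of variance v observed as z = h w +
  noise of variance b: prior times likelihood is the law of the observation times the posterior,
  whose mean is \<open>of_real (v / q) * cnj h * z\<close> and whose variance is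
  \<open>b * v / q\<close>.\<close>

lemma cnormal_density_mult:
  assumes "0 < v" "0 < b" and q_def: "q = b + (cmod h)\<^sup>2 * v"
  shows "cnormal_density v w * cnormal_density b (z - h * w) =
    cnormal_density q z * cnormal_density (b * v / q) (w - of_real (v / q) * cnj h * z)"
proof -
  have q: "0 < q" using assms by (simp add: add_pos_nonneg)
  define x y where "x = Re z" and "y = Im z"
  define h1 h2 where "h1 = Re h" and "h2 = Im h"
  define w1 w2 where "w1 = Re w" and "w2 = Im w"
  have qq: "q = b + (h1\<^sup>2 + h2\<^sup>2) * v" by (simp add: q_def h1_def h2_def cmod_power2)
  have "- (cmod w)\<^sup>2 / v + - (cmod (z - h * w))\<^sup>2 / b =
    - (cmod z)\<^sup>2 / q + - (cmod (w - of_real (v / q) * cnj h * z))\<^sup>2 / (b * v / q)"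
  proof -
    have 1: "(cmod w)\<^sup>2 = w1\<^sup>2 + w2\<^sup>2" "(cmod z)\<^sup>2 = x\<^sup>2 + y\<^sup>2" by (simp_all add: cmod_power2 w1_def w2_def x_def y_def)
    have 2: "(cmod (z - h * w))\<^sup>2 = (x - (h1 * w1 - h2 * w2))\<^sup>2 + (y - (h1 * w2 + h2 * w1))\<^sup>2"
      by (simp add: cmod_power2 w1_def w2_def x_def y_def h1_def h2_def)
    have 3: "(cmod (w - of_real (v / q) * cnj h * z))\<^sup>2 =
      (w1 - v * (h1 * x + h2 * y) / q)\<^sup>2 + (w2 - v * (h1 * y - h2 * x) / q)\<^sup>2"
      by (simp add: cmod_power2 w1_def w2_def x_def y_def h1_def h2_def algebra_simps)
    have 4: "(A - B / q)\<^sup>2 / (b * v / q) = (q * A - B)\<^sup>2 / (q * b * v)" for A B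
      using q assms(1,2) by (simp add: field_simps power2_eq_square)
    \<comment> \<open>Up to the common factor \<open>v * b\<close>, this is the identity of
      exponents with denominators cleared, a polynomial identity once q is expanded. Fact 6 restores
      the denominators.\<close>
    have 5: "(v * b) * ((q * w1 - v * (h1 * x + h2 * y))\<^sup>2 + (q * w2 - v * (h1 * y - h2 * x))\<^sup>2 + (x\<^sup>2 + y\<^sup>2) * (b * v)) =
       (v * b) * (q * ((w1\<^sup>2 + w2\<^sup>2) * b + ((x - (h1 * w1 - h2 * w2))\<^sup>2 + (y - (h1 * w2 + h2 * w1))\<^sup>2) * v))"
      unfolding qq by algebra
    have 6: "P / v + R / b = S / q + (T + U) / (q * b * v)"
      if "T + U + S * (b * v) = q * (P * b + R * v)" for P R S T U
    proof -
      have "S / q + (T + U) / (q * b * v) = (T + U + S * (b * v)) / (q * b * v)"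
        using q assms(1,2) by (simp add: field_simps)
      also have "\<dots> = P / v + R / b" unfolding that using q assms(1,2) by (simp add: field_simps)
      finally show ?thesis ..
    qed
    have "(w1\<^sup>2 + w2\<^sup>2) / v + ((x - (h1 * w1 - h2 * w2))\<^sup>2 + (y - (h1 * w2 + h2 * w1))\<^sup>2) / b =
      (x\<^sup>2 + y\<^sup>2) / q + ((q * w1 - v * (h1 * x + h2 * y))\<^sup>2 + (q * w2 - v * (h1 * y - h2 * x))\<^sup>2) / (q * b * v)"
      by (rule 6) (use 5 assms in simp)
    also have "\<dots> = (x\<^sup>2 + y\<^sup>2) / q + ((w1 - v * (h1 * x + h2 * y) / q)\<^sup>2 + (w2 - v * (h1 * y - h2 * x) / q)\<^sup>2) / (b * v / q)"
      by (simp only: add_divide_distrib 4)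
    finally show ?thesis
      unfolding 1 2 3 by (simp only: minus_divide_left[symmetric] minus_add_distrib[symmetric])
  qed
  then have "exp (- (cmod w)\<^sup>2 / v) * exp (- (cmod (z - h * w))\<^sup>2 / b) =
    exp (- (cmod z)\<^sup>2 / q) * exp (- (cmod (w - of_real (v / q) * cnj h * z))\<^sup>2 / (b * v / q))"
    by (simp only: mult_exp_exp)
  moreover have "(pi * v) * (pi * b) = (pi * q) * (pi * (b * v / q))" using q by simp
  ultimately show ?thesis
    unfolding cnormal_density_def times_divide_times_eq by simp
qed

text \<open>After the integrals are exchanged, the posterior density of
  \<open>cnormal_density_mult\<close> integrates to 1 and the law of the observation remains. The
  case v = 0 covers vanishing distortion; b is positive so that the sum has a density.\<close>

lemma nn_integral_cnormal_add:
  assumes v: "0 \<le> v" and b: "0 < b" and [measurable]: "f \<in> borel_measurable borel"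
  shows "(\<integral>\<^sup>+w. \<integral>\<^sup>+z. f (h * w + z) \<partial>cnormal b \<partial>cnormal v) = (\<integral>\<^sup>+z. f z \<partial>cnormal (b + (cmod h)\<^sup>2 * v))"
proof (cases "v = 0")
  case True
  interpret prob_space "cnormal b" using b by (intro prob_space_cnormal) simp
  show ?thesis using True by (simp add: cnormal_0 nn_integral_return)
next
  case False
  then have v: "0 < v" using v by simp
  define q where "q = b + (cmod h)\<^sup>2 * v"
  have q: "0 < q" using v b by (simp add: q_def add_pos_nonneg)
  interpret b: prob_space "cnormal b" using b by (intro prob_space_cnormal) simp
  have "(\<integral>\<^sup>+w. \<integral>\<^sup>+z. f (h * w + z) \<partial>cnormal b \<partial>cnormal v) =
    (\<integral>\<^sup>+w. \<integral>\<^sup>+z. ennreal (cnormal_density v w) * (ennreal (cnormal_density b z) * f (h * w + z)) \<partial>lborel \<partial>lborel)"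
    using v b by (simp add: nn_integral_cnormal nn_integral_cmult)
  also have "\<dots> = (\<integral>\<^sup>+w. \<integral>\<^sup>+z. ennreal (cnormal_density v w) * (ennreal (cnormal_density b (z - h * w)) * f z) \<partial>lborel \<partial>lborel)"
    (is "(\<integral>\<^sup>+w. ?L w \<partial>_) = (\<integral>\<^sup>+w. ?R w \<partial>_)")
  proof (rule nn_integral_cong)
    fix w
    show "?L w = ?R w"
      using nn_integral_lborel_shift[of "\<lambda>z. ennreal (cnormal_density v w) * (ennreal (cnormal_density b (z - h * w)) * f z)" "h * w"]
      by (simp add: add.commute)
  qed
  also have "\<dots> = (\<integral>\<^sup>+z. \<integral>\<^sup>+w. ennreal (cnormal_density v w) * (ennreal (cnormal_density b (z - h * w)) * f z) \<partial>lborel \<partial>lborel)"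
    by (rule lborel_pair.Fubini') simp
  also have "\<dots> = (\<integral>\<^sup>+z. \<integral>\<^sup>+w. (ennreal (cnormal_density q z) * f z) * ennreal (cnormal_density (b * v / q) (w - of_real (v / q) * cnj h * z)) \<partial>lborel \<partial>lborel)"
  proof (rule nn_integral_cong, rule nn_integral_cong)
    fix z w
    show "ennreal (cnormal_density v w) * (ennreal (cnormal_density b (z - h * w)) * f z) =
      (ennreal (cnormal_density q z) * f z) * ennreal (cnormal_density (b * v / q) (w - of_real (v / q) * cnj h * z))"
    proof -
      have "ennreal (cnormal_density v w) * ennreal (cnormal_density b (z - h * w)) =
        ennreal (cnormal_density q z) * ennreal (cnormal_density (b * v / q) (w - of_real (v / q) * cnj h * z))"
        using v b q by (simp only: ennreal_mult[symmetric] cnormal_density_pos less_imp_le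
          divide_pos_pos mult_pos_pos cnormal_density_mult[OF v b q_def, of w z])
      then show ?thesis by (simp only: mult.assoc[symmetric]) (simp only: mult.assoc mult.commute[of "f z"])
    qed
  qed
  also have "\<dots> = (\<integral>\<^sup>+z. ennreal (cnormal_density q z) * f z \<partial>lborel)"
  proof (rule nn_integral_cong)
    fix z
    have "(\<integral>\<^sup>+w. ennreal (cnormal_density (b * v / q) (w - of_real (v / q) * cnj h * z)) \<partial>lborel) = 1"
      using nn_integral_lborel_shift[of "\<lambda>w. ennreal (cnormal_density (b * v / q) w)" "- (of_real (v / q) * cnj h * z)"]
        nn_integral_cnormal_density[of "b * v / q"] v b q by simp
    then show "(\<integral>\<^sup>+w. (ennreal (cnormal_density q z) * f z) * ennreal (cnormal_density (b * v / q) (w - of_real (v / q) * cnj h * z)) \<partial>lborel)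
      = ennreal (cnormal_density q z) * f z"
      by (subst nn_integral_cmult) simp_all
  qed
  finally show ?thesis using q by (simp add: nn_integral_cnormal q_def)
qed

text \<open>The reference law for the pair (u x + n, w) is CN(0, N + P) times J. Since w is
  independent of the rest, the likelihood ratio involves only x and u x + n. Its logarithm is
  quadratic, so the input law enters through the second moment of u x alone.\<close>

lemma gaussian_mutual_information_le:
  fixes u :: "'x \<Rightarrow> complex" and J :: "'w measure"
  assumes f: "prob_space f" and J: "prob_space J"
    and sets_f [measurable_cong]: "sets f = sets S"
    and u [measurable]: "u \<in> borel_measurable S"
    and F [measurable]: "F \<in> borel \<Otimes>\<^sub>M J \<rightarrow>\<^sub>M T"
    and N: "0 < N" and P: "0 \<le> P" and power: "(\<integral>\<^sup>+x. ennreal ((cmod (u x))\<^sup>2) \<partial>f) \<le> ennreal P"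
  shows "prob_space.mutual_information (f \<Otimes>\<^sub>M cnormal N \<Otimes>\<^sub>M J) 2 S T fst (\<lambda>(x, n, w). F (u x + n, w))
    \<le> log 2 (1 + P / N)"
proof -
  let ?C = "cnormal N" and ?D = "cnormal (N + P)"
  define \<Omega> where "\<Omega> = f \<Otimes>\<^sub>M ?C \<Otimes>\<^sub>M J"
  interpret f: prob_space f by fact
  interpret J: prob_space J by fact
  interpret C: prob_space ?C using N by (intro prob_space_cnormal) simp
  interpret D: prob_space ?D using N P by (intro prob_space_cnormal) simp
  interpret CJ: pair_prob_space ?C J ..
  interpret DJ: pair_prob_space ?D J ..
  interpret \<Omega>: pair_prob_space f "?C \<Otimes>\<^sub>M J" ..
  interpret fD: pair_prob_space f "?D \<Otimes>\<^sub>M J" ..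
  interpret information_space \<Omega> 2
    unfolding \<Omega>_def by unfold_locales simp
  have [measurable_cong]: "sets \<Omega> = sets (S \<Otimes>\<^sub>M borel \<Otimes>\<^sub>M J)"
    unfolding \<Omega>_def by (intro sets_pair_measure_cong) (simp_all add: sets_f)
  define Z where "Z = (\<lambda>(x, n, w). (u x + n, w :: 'w))"
  define a where "a = (\<lambda>(x, v, w :: 'w). cnormal_density N (v - u x) / cnormal_density (N + P) v)"
  have distr_f: "distr \<Omega> S fst = f"
  proof -
    have "distr \<Omega> S fst = distr \<Omega> f fst" by (rule distr_cong) (simp_all add: sets_f)
    then show ?thesis unfolding \<Omega>_def by (simp add: CJ.distr_pair_fst)
  qed
  have nn_\<Omega>: "(\<integral>\<^sup>+\<omega>. g \<omega> \<partial>\<Omega>) = (\<integral>\<^sup>+x. \<integral>\<^sup>+n. \<integral>\<^sup>+w. g (x, n, w) \<partial>J \<partial>?C \<partial>f)"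
    if [measurable]: "g \<in> borel_measurable \<Omega>" for g
  proof -
    note m = that[unfolded \<Omega>_def]
    have "(\<integral>\<^sup>+\<omega>. g \<omega> \<partial>\<Omega>) = (\<integral>\<^sup>+x. \<integral>\<^sup>+p. g (x, p) \<partial>(?C \<Otimes>\<^sub>M J) \<partial>f)"
      unfolding \<Omega>_def by (rule CJ.nn_integral_fst[OF m, symmetric])
    also have "\<dots> = (\<integral>\<^sup>+x. \<integral>\<^sup>+n. \<integral>\<^sup>+w. g (x, n, w) \<partial>J \<partial>?C \<partial>f)"
      by (intro nn_integral_cong J.nn_integral_fst[symmetric] measurable_compose[OF _ m] measurable_Pair1')
    finally show ?thesis .
  qed
  have distr_n: "distr \<Omega> borel (\<lambda>\<omega>. fst (snd \<omega>)) = ?C"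
  proof (rule measure_eqI)
    fix A assume "A \<in> sets (distr \<Omega> borel (\<lambda>\<omega>. fst (snd \<omega>)))"
    then have [measurable]: "A \<in> sets borel" by simp
    have "emeasure (distr \<Omega> borel (\<lambda>\<omega>. fst (snd \<omega>))) A = (\<integral>\<^sup>+n. indicator A n \<partial>distr \<Omega> borel (\<lambda>\<omega>. fst (snd \<omega>)))"
      by simp
    also have "\<dots> = (\<integral>\<^sup>+\<omega>. indicator A (fst (snd \<omega>)) \<partial>\<Omega>)"
      by (subst nn_integral_distr) simp_all
    also have "\<dots> = emeasure ?C A"
      by (subst nn_\<Omega>) (simp_all add: J.emeasure_space_1 f.emeasure_space_1)
    finally show "emeasure (distr \<Omega> borel (\<lambda>\<omega>. fst (snd \<omega>))) A = emeasure ?C A" .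
  qed simp
  have Y: "(\<lambda>(x, n, w). F (u x + n, w)) = (\<lambda>\<omega>. F (Z \<omega>))"
    by (auto simp: Z_def)
  \<comment> \<open>The squares are expanded into two powers and a cross term. If u x has power P,
    the non-constant part has mean 0; for smaller power its mean is negative.\<close>
  have logA: "log 2 (a (x, u x + n, w)) =
    log 2 (1 + P / N) + (((cmod (u x))\<^sup>2 + 2 * (u x \<bullet> n) + (cmod n)\<^sup>2) / (N + P) - (cmod n)\<^sup>2 / N) / ln 2" for x n w
  proof -
    have "a (x, u x + n, w) = (1 + P / N) * exp ((cmod (u x + n))\<^sup>2 / (N + P) - (cmod n)\<^sup>2 / N)"
    proof -
      have "x / (pi * N) / (y / (pi * (N + P))) = (1 + P / N) * (x / y)" if "y \<noteq> 0" for x y :: real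
        using N P that by (simp add: field_simps)
      from this[of "exp (- (cmod (u x + n))\<^sup>2 / (N + P))" "exp (- (cmod n)\<^sup>2 / N)"]
      show ?thesis
        unfolding a_def cnormal_density_def exp_diff[symmetric] by (simp add: add.commute)
    qed
    moreover have "(cmod (u x + n))\<^sup>2 = (cmod (u x))\<^sup>2 + 2 * (u x \<bullet> n) + (cmod n)\<^sup>2"
      by (simp add: power2_norm_eq_inner inner_add inner_commute)
    moreover have "1 + P / N > 0" using N P by (simp add: add_pos_nonneg)
    ultimately show ?thesis
      using N P by (simp add: log_def ln_mult add_divide_distrib)
  qed
  have int_n: "integrable \<Omega> (\<lambda>(x, n, w). (cmod n)\<^sup>2)" and E_n: "(\<integral>(x, n, w). (cmod n)\<^sup>2 \<partial>\<Omega>) = N"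
  proof -
    have "integrable (distr \<Omega> borel (\<lambda>\<omega>. fst (snd \<omega>))) (\<lambda>n. (cmod n)\<^sup>2)"
      unfolding distr_n using N by (simp add: integrable_cnormal_norm2)
    then show "integrable \<Omega> (\<lambda>(x, n, w). (cmod n)\<^sup>2)"
      by (subst (asm) integrable_distr_eq) (simp_all add: split_beta')
    have "(\<integral>n. (cmod n)\<^sup>2 \<partial>distr \<Omega> borel (\<lambda>\<omega>. fst (snd \<omega>))) = N"
      unfolding distr_n using N by (simp add: integral_cnormal_norm2)
    then show "(\<integral>(x, n, w). (cmod n)\<^sup>2 \<partial>\<Omega>) = N"
      by (subst (asm) integral_distr) (simp_all add: split_beta')
  qed
  have int_u: "integrable \<Omega> (\<lambda>(x, n, w). (cmod (u x))\<^sup>2)" and E_u: "(\<integral>(x, n, w). (cmod (u x))\<^sup>2 \<partial>\<Omega>) \<le> P"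
  proof -
    have i: "integrable f (\<lambda>x. (cmod (u x))\<^sup>2)"
      using power by (intro integrableI_nonneg) (auto simp: top_unique le_less_trans)
    then have "integrable (distr \<Omega> S fst) (\<lambda>x. (cmod (u x))\<^sup>2)" by (simp add: distr_f)
    then show "integrable \<Omega> (\<lambda>(x, n, w). (cmod (u x))\<^sup>2)"
      by (subst (asm) integrable_distr_eq) (simp_all add: split_beta')
    have "(\<integral>x. (cmod (u x))\<^sup>2 \<partial>distr \<Omega> S fst) \<le> P"
      unfolding distr_f using power P i by (subst (asm) nn_integral_eq_integral) simp_all
    then show "(\<integral>(x, n, w). (cmod (u x))\<^sup>2 \<partial>\<Omega>) \<le> P"
      by (subst (asm) integral_distr) (simp_all add: split_beta')
  qed
  have int_un: "integrable \<Omega> (\<lambda>(x, n, w). u x \<bullet> n)"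
  proof (rule Bochner_Integration.integrable_bound[OF Bochner_Integration.integrable_add[OF int_u int_n]])
    have "\<bar>u x \<bullet> n\<bar> \<le> (cmod (u x))\<^sup>2 + (cmod n)\<^sup>2" for x n
      by (rule abs_inner_le_norm2)
    then show "AE \<omega> in \<Omega>. norm (case \<omega> of (x, n, w) \<Rightarrow> u x \<bullet> n) \<le>
      norm ((case \<omega> of (x, n, w) \<Rightarrow> (cmod (u x))\<^sup>2) + (case \<omega> of (x, n, w) \<Rightarrow> (cmod n)\<^sup>2))"
      by (auto simp: split_beta')
  qed measurable
  \<comment> \<open>Given x, the noise still has mean zero, so the inner integral vanishes for every
    x.\<close>
  have E_un: "(\<integral>(x, n, w). u x \<bullet> n \<partial>\<Omega>) = 0"
  proof -
    have "(\<integral>(x, n, w). u x \<bullet> n \<partial>\<Omega>) = (\<integral>x. \<integral>p. (case (x, p) of (x, n, w) \<Rightarrow> u x \<bullet> n) \<partial>(?C \<Otimes>\<^sub>M J) \<partial>f)"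
      using int_un unfolding \<Omega>_def by (rule \<Omega>.integral_fst'[symmetric])
    also have "\<dots> = (\<integral>x. 0 \<partial>f)"
    proof (rule Bochner_Integration.integral_cong[OF refl])
      fix x
      have "(\<integral>p. (case (x, p) of (x, n, w) \<Rightarrow> u x \<bullet> n) \<partial>(?C \<Otimes>\<^sub>M J)) = (\<integral>n. u x \<bullet> n \<partial>distr (?C \<Otimes>\<^sub>M J) ?C fst)"
        by (subst integral_distr) (simp_all add: split_beta')
      also have "\<dots> = 0" by (simp only: J.distr_pair_fst integral_cnormal_inner)
      finally show "(\<integral>p. (case (x, p) of (x, n, w) \<Rightarrow> u x \<bullet> n) \<partial>(?C \<Otimes>\<^sub>M J)) = 0" .
    qed
    finally show ?thesis by simp
  qed
  have a_pos: "0 < a p" for p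
    using N P by (simp add: a_def cnormal_density_pos split: prod.split)
  have Z_measurable [measurable]: "Z \<in> \<Omega> \<rightarrow>\<^sub>M borel \<Otimes>\<^sub>M J" unfolding Z_def by measurable
  have a_measurable [measurable]: "a \<in> borel_measurable (S \<Otimes>\<^sub>M borel \<Otimes>\<^sub>M J)" unfolding a_def by measurable
  show ?thesis
    unfolding Y \<Omega>_def[symmetric]
  proof (rule mutual_information_le_expectation_log[where U = "borel \<Otimes>\<^sub>M J" and \<nu> = "?D \<Otimes>\<^sub>M J" and a = a])
    show "0 < a p" for p by (rule a_pos)
    show "distr \<Omega> (S \<Otimes>\<^sub>M borel \<Otimes>\<^sub>M J) (\<lambda>\<omega>. (fst \<omega>, Z \<omega>)) =
      density (distr \<Omega> S fst \<Otimes>\<^sub>M ?D \<Otimes>\<^sub>M J) (\<lambda>p. ennreal (a p))"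
      (is "?L = ?R")
    proof (rule measure_eqI)
      show "sets ?L = sets ?R"
        by (simp add: distr_f) (intro sets_pair_measure_cong, simp_all add: sets_f)
      fix A assume "A \<in> sets ?L"
      then have A [measurable]: "A \<in> sets (S \<Otimes>\<^sub>M borel \<Otimes>\<^sub>M J)" by simp
      define G where "G x v = (\<integral>\<^sup>+w. indicator A (x, v, w) \<partial>J)" for x v
      have G [measurable]: "(\<lambda>(x, v). G x v) \<in> borel_measurable (S \<Otimes>\<^sub>M borel)"
        unfolding G_def by measurable
      have "emeasure ?L A = (\<integral>\<^sup>+p. indicator A p \<partial>?L)" by simp
      also have "\<dots> = (\<integral>\<^sup>+\<omega>. indicator A (fst \<omega>, Z \<omega>) \<partial>\<Omega>)"
        by (rule nn_integral_distr) measurable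
      also have "\<dots> = (\<integral>\<^sup>+x. \<integral>\<^sup>+n. G x (u x + n) \<partial>?C \<partial>f)"
        by (subst nn_\<Omega>) (simp_all add: G_def Z_def)
      \<comment> \<open>The ratio \<open>a\<close> ignores its third component. The value
        \<open>undefined\<close> fills that slot while w is integrated out in \<open>G\<close>; the
        true w returns below.\<close>
      also have "\<dots> = (\<integral>\<^sup>+x. \<integral>\<^sup>+v. ennreal (a (x, v, undefined)) * G x v \<partial>?D \<partial>f)"
      proof (rule nn_integral_cong)
        fix x assume "x \<in> space f"
        then have x [measurable]: "x \<in> space S" by (simp add: sets_eq_imp_space_eq[OF sets_f])
        have "(\<integral>\<^sup>+n. G x (u x + n) \<partial>?C) = (\<integral>\<^sup>+n. ennreal (cnormal_density N n) * G x (u x + n) \<partial>lborel)"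
          using N by (simp add: nn_integral_cnormal)
        also have "\<dots> = (\<integral>\<^sup>+v. ennreal (cnormal_density N (v - u x)) * G x v \<partial>lborel)"
          using nn_integral_lborel_shift[of "\<lambda>v. ennreal (cnormal_density N (v - u x)) * G x v" "u x"]
          by (simp add: add.commute)
        also have "\<dots> = (\<integral>\<^sup>+v. ennreal (cnormal_density (N + P) v) * (ennreal (a (x, v, undefined)) * G x v) \<partial>lborel)"
        proof (rule nn_integral_cong)
          fix v
          have "cnormal_density N (v - u x) = cnormal_density (N + P) v * a (x, v, undefined)"
            using cnormal_density_pos[of "N + P" v] N P by (simp add: a_def)
          then show "ennreal (cnormal_density N (v - u x)) * G x v =
              ennreal (cnormal_density (N + P) v) * (ennreal (a (x, v, undefined)) * G x v)"
            using a_pos cnormal_density_pos[of "N + P" v] N P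
            by (simp add: ennreal_mult less_imp_le mult.assoc)
        qed
        also have "\<dots> = (\<integral>\<^sup>+v. ennreal (a (x, v, undefined)) * G x v \<partial>?D)"
          using N P by (subst nn_integral_cnormal) (simp_all add: a_def)
        finally show "(\<integral>\<^sup>+n. G x (u x + n) \<partial>?C) = (\<integral>\<^sup>+v. ennreal (a (x, v, undefined)) * G x v \<partial>?D)" .
      qed
      also have "\<dots> = (\<integral>\<^sup>+x. \<integral>\<^sup>+v. \<integral>\<^sup>+w. ennreal (a (x, v, w)) * indicator A (x, v, w) \<partial>J \<partial>?D \<partial>f)"
        unfolding G_def
        by (intro nn_integral_cong) (simp add: a_def sets_eq_imp_space_eq[OF sets_f] nn_integral_cmult)
      also have "\<dots> = (\<integral>\<^sup>+x. \<integral>\<^sup>+p. ennreal (a (x, p)) * indicator A (x, p) \<partial>(?D \<Otimes>\<^sub>M J) \<partial>f)"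
        by (intro nn_integral_cong, subst J.nn_integral_fst[symmetric])
          (simp_all add: sets_eq_imp_space_eq[OF sets_f])
      also have "\<dots> = (\<integral>\<^sup>+p. ennreal (a p) * indicator A p \<partial>(f \<Otimes>\<^sub>M ?D \<Otimes>\<^sub>M J))"
        by (subst DJ.nn_integral_fst[symmetric]) simp_all
      also have "\<dots> = emeasure ?R A"
        unfolding distr_f by (subst emeasure_density) simp_all
      finally show "emeasure ?L A = emeasure ?R A" .
    qed
    have eq: "(\<lambda>\<omega>. log 2 (a (fst \<omega>, Z \<omega>))) = (\<lambda>\<omega>. log 2 (1 + P / N) +
      ((case \<omega> of (x, n, w) \<Rightarrow> (cmod (u x))\<^sup>2) + 2 * (case \<omega> of (x, n, w) \<Rightarrow> u x \<bullet> n) +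
        (case \<omega> of (x, n, w) \<Rightarrow> (cmod n)\<^sup>2)) / (N + P) / ln 2
      - (case \<omega> of (x, n, w) \<Rightarrow> (cmod n)\<^sup>2) / N / ln 2)"
      by (auto simp: Z_def logA diff_divide_distrib fun_eq_iff)
    show "integrable \<Omega> (\<lambda>\<omega>. log 2 (a (fst \<omega>, Z \<omega>)))"
      unfolding eq by (intro Bochner_Integration.integrable_add Bochner_Integration.integrable_diff
        integrable_divide integrable_mult_right int_n int_u int_un) simp
    have "(\<integral>\<omega>. log 2 (a (fst \<omega>, Z \<omega>)) \<partial>\<Omega>) = log 2 (1 + P / N) +
      ((\<integral>(x, n, w). (cmod (u x))\<^sup>2 \<partial>\<Omega>) + N) / (N + P) / ln 2 - N / N / ln 2"
      unfolding eq using int_n int_u int_un by (simp add: E_n E_un prob_space)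
    also have "\<dots> \<le> log 2 (1 + P / N) + (P + N) / (N + P) / ln 2 - N / N / ln 2"
      using N P E_u by (intro diff_right_mono add_left_mono divide_right_mono add_right_mono) auto
    also have "\<dots> = log 2 (1 + P / N)" using N P by (simp add: add.commute)
    finally show "(\<integral>\<omega>. log 2 (a (fst \<omega>, Z \<omega>)) \<partial>\<Omega>) \<le> log 2 (1 + P / N)" .
    show "0 \<le> log 2 (1 + P / N)" using N P by (simp add: add_pos_nonneg)
    show "prob_space (?D \<Otimes>\<^sub>M J)" by unfold_locales

    show "sets (?D \<Otimes>\<^sub>M J) = sets (borel \<Otimes>\<^sub>M J)" by (rule sets_pair_measure_cong) simp_all
  qed measurable
qed

section \<open>Laws with independent components\<close>

lemma borel_measurable_vec_nth [measurable]:
  "(\<lambda>x. x $ i) \<in> borel_measurable (borel :: ('a::euclidean_space ^ 'n::finite) measure)"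
  by (intro borel_measurable_continuous_onI continuous_intros)

lemma borel_measurable_vec_lambda [measurable (raw)]:
  fixes f :: "'n::finite \<Rightarrow> 'x \<Rightarrow> 'a::euclidean_space"
  assumes "\<And>i. f i \<in> borel_measurable M"
  shows "(\<lambda>x. \<chi> i. f i x) \<in> borel_measurable M"
proof (subst borel_measurable_euclidean_space, rule ballI)
  fix b :: "'a ^ 'n" assume "b \<in> Basis"
  then obtain i c where b: "b = axis i c" by (auto simp: Basis_vec_def)
  show "(\<lambda>x. (\<chi> i. f i x) \<bullet> b) \<in> borel_measurable M"
    using assms[of i] by (simp add: b inner_axis)
qed

lemma borel_measurable_vector_scalar_mult [measurable (raw)]:
  fixes f :: "'x \<Rightarrow> complex" and g :: "'x \<Rightarrow> complex ^ 'n::finite"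
  assumes [measurable]: "f \<in> borel_measurable M" "g \<in> borel_measurable M"
  shows "(\<lambda>x. f x *s g x) \<in> borel_measurable M"
  unfolding vector_scalar_mult_def by measurable

definition vec_measure :: "('n \<Rightarrow> complex measure) \<Rightarrow> (complex ^ 'n::finite) measure" where
  "vec_measure \<mu> = distr (\<Pi>\<^sub>M i\<in>UNIV. \<mu> i) borel (\<lambda>x. \<chi> i. x i)"

lemma cnormal_diag_eq_vec_measure: "cnormal_diag v = vec_measure (\<lambda>i. cnormal (v i))"
  by (simp add: cnormal_diag_def vec_measure_def)

lemma sets_vec_measure [simp, measurable_cong]: "sets (vec_measure \<mu>) = sets borel"
  by (simp add: vec_measure_def)

lemma space_vec_measure [simp]: "space (vec_measure \<mu>) = UNIV"
  by (simp add: vec_measure_def)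

lemma sets_cnormal_diag [simp, measurable_cong]: "sets (cnormal_diag v) = sets borel"
  by (simp add: cnormal_diag_def)

lemma space_cnormal_diag [simp]: "space (cnormal_diag v) = UNIV"
  by (simp add: cnormal_diag_def)

context
  fixes \<mu> :: "'n::finite \<Rightarrow> complex measure"
  assumes prob: "\<And>i. prob_space (\<mu> i)" and sets_\<mu> [measurable_cong]: "\<And>i. sets (\<mu> i) = sets borel"
begin

lemma measurable_vec_lambda_PiM [measurable]: "(\<lambda>x. \<chi> i. x i) \<in> (\<Pi>\<^sub>M i\<in>UNIV. \<mu> i) \<rightarrow>\<^sub>M borel"
  by (rule borel_measurable_vec_lambda) simp

lemma prob_space_vec_measure: "prob_space (vec_measure \<mu>)"
  unfolding vec_measure_def
  by (intro prob_space.prob_space_distr prob_space_PiM prob measurable_vec_lambda_PiM)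

lemma nn_integral_vec_measure_prod:
  assumes [measurable]: "\<And>i. f i \<in> borel_measurable borel"
  shows "(\<integral>\<^sup>+x. (\<Prod>i\<in>UNIV. f i (x $ i)) \<partial>vec_measure \<mu>) = (\<Prod>i\<in>UNIV. \<integral>\<^sup>+x. f i x \<partial>\<mu> i)"
proof -
  interpret product_sigma_finite \<mu>
    by (intro product_sigma_finite.intro prob_space_imp_sigma_finite prob)
  have "(\<integral>\<^sup>+x. (\<Prod>i\<in>UNIV. f i (x $ i)) \<partial>vec_measure \<mu>) = (\<integral>\<^sup>+x. (\<Prod>i\<in>UNIV. f i (x i)) \<partial>(\<Pi>\<^sub>M i\<in>UNIV. \<mu> i))"
    unfolding vec_measure_def by (subst nn_integral_distr) simp_all
  then show ?thesis by (simp add: product_nn_integral_prod)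
qed

text \<open>Boxes determine a product law, and vectors correspond to functions on the index set by a
  measurable bijection. The indicator of a box is written as a product so that the hypothesis can be
  checked with \<open>nn_integral_vec_measure_prod\<close>.\<close>

lemma vec_measure_eqI:
  assumes sets_P [measurable_cong]: "sets P = sets borel"
    and eq: "\<And>A. (\<And>i. A i \<in> sets borel) \<Longrightarrow>
      (\<integral>\<^sup>+x. (\<Prod>i\<in>UNIV. indicator (A i) (x $ i)) \<partial>P) = (\<Prod>i\<in>UNIV. emeasure (\<mu> i) (A i))"
  shows "P = vec_measure \<mu>"
proof -
  interpret product_sigma_finite \<mu>
    by (intro product_sigma_finite.intro prob_space_imp_sigma_finite prob)
  have m [measurable]: "(\<lambda>x i. x $ i) \<in> P \<rightarrow>\<^sub>M (\<Pi>\<^sub>M i\<in>UNIV. \<mu> i)"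
    by (rule measurable_PiM_single') (auto simp: space_PiM sets_eq_imp_space_eq[OF sets_\<mu>])
  have "distr P (\<Pi>\<^sub>M i\<in>UNIV. \<mu> i) (\<lambda>x i. x $ i) = (\<Pi>\<^sub>M i\<in>UNIV. \<mu> i)"
  proof (rule PiM_eqI)
    fix A assume "\<And>i. i \<in> UNIV \<Longrightarrow> A i \<in> sets (\<mu> i)"
    then have A [measurable]: "A i \<in> sets borel" for i by (simp add: sets_\<mu>)
    have [measurable]: "Pi\<^sub>E UNIV A \<in> sets (\<Pi>\<^sub>M i\<in>UNIV. \<mu> i)"
      by (rule sets_PiM_I_finite) (simp_all add: sets_\<mu>)
    have "emeasure (distr P (\<Pi>\<^sub>M i\<in>UNIV. \<mu> i) (\<lambda>x i. x $ i)) (Pi\<^sub>E UNIV A) =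
       (\<integral>\<^sup>+x. indicator (Pi\<^sub>E UNIV A) x \<partial>distr P (\<Pi>\<^sub>M i\<in>UNIV. \<mu> i) (\<lambda>x i. x $ i))" by simp
    also have "\<dots> = (\<integral>\<^sup>+x. indicator (Pi\<^sub>E UNIV A) (\<lambda>i. x $ i) \<partial>P)"
      by (rule nn_integral_distr) measurable
    also have "\<dots> = (\<integral>\<^sup>+x. (\<Prod>i\<in>UNIV. indicator (A i) (x $ i)) \<partial>P)"
    proof (rule nn_integral_cong)
      fix x :: "complex ^ 'n"
      show "indicator (Pi\<^sub>E UNIV A) (\<lambda>i. x $ i) = (\<Prod>i\<in>UNIV. indicator (A i) (x $ i) :: ennreal)"
      proof (cases "\<forall>i. x $ i \<in> A i")
        case False
        then obtain j where "x $ j \<notin> A j" by blast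
        then show ?thesis by (subst prod_zero[of UNIV]) (auto simp: indicator_def PiE_iff)
      qed (simp add: PiE_iff)
    qed
    finally show "emeasure (distr P (\<Pi>\<^sub>M i\<in>UNIV. \<mu> i) (\<lambda>x i. x $ i)) (Pi\<^sub>E UNIV A) = (\<Prod>i\<in>UNIV. emeasure (\<mu> i) (A i))"
      using eq[OF A] by simp
  qed simp_all
  then have "vec_measure \<mu> = distr (distr P (\<Pi>\<^sub>M i\<in>UNIV. \<mu> i) (\<lambda>x i. x $ i)) borel (\<lambda>x. \<chi> i. x i)"
    by (simp add: vec_measure_def)
  also have "\<dots> = P"
    by (subst distr_distr) (simp_all add: comp_def distr_id2 sets_P)
  finally show ?thesis ..
qed

end

lemma prob_space_cnormal_diag: "(\<And>i. 0 \<le> v i) \<Longrightarrow> prob_space (cnormal_diag v)"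
  unfolding cnormal_diag_eq_vec_measure by (intro prob_space_vec_measure prob_space_cnormal) simp_all

text \<open>Tested on boxes, the double integral factors over the components, and each factor is an
  instance of \<open>nn_integral_cnormal_add\<close>.\<close>

lemma nn_integral_cnormal_diag_add:
  assumes v: "\<And>i. 0 \<le> v i" and b: "\<And>i. 0 < b i" and [measurable]: "f \<in> borel_measurable borel"
  shows "(\<integral>\<^sup>+x. \<integral>\<^sup>+y. f (x + y) \<partial>cnormal_diag b \<partial>cnormal_diag v) = (\<integral>\<^sup>+x. f x \<partial>cnormal_diag (\<lambda>i. v i + b i))"
proof -
  interpret B: prob_space "cnormal_diag b" by (intro prob_space_cnormal_diag less_imp_le b)
  interpret V: prob_space "cnormal_diag v" by (intro prob_space_cnormal_diag v)
  interpret BV: pair_prob_space "cnormal_diag v" "cnormal_diag b" ..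
  define P where "P = distr (cnormal_diag v \<Otimes>\<^sub>M cnormal_diag b) borel (\<lambda>(x, y). x + y)"
  have nn_P: "(\<integral>\<^sup>+x. g x \<partial>P) = (\<integral>\<^sup>+x. \<integral>\<^sup>+y. g (x + y) \<partial>cnormal_diag b \<partial>cnormal_diag v)"
    if [measurable]: "g \<in> borel_measurable borel" for g
    unfolding P_def by (subst nn_integral_distr, simp_all, subst B.nn_integral_fst[symmetric], simp_all)
  have "P = cnormal_diag (\<lambda>i. v i + b i)"
    unfolding cnormal_diag_eq_vec_measure
  proof (rule vec_measure_eqI)
    fix A :: "'a \<Rightarrow> complex set" assume [measurable]: "\<And>i. A i \<in> sets borel"
    have "(\<integral>\<^sup>+x. (\<Prod>i\<in>UNIV. indicator (A i) (x $ i)) \<partial>P) =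
      (\<integral>\<^sup>+x. \<integral>\<^sup>+y. (\<Prod>i\<in>UNIV. indicator (A i) (x $ i + y $ i)) \<partial>cnormal_diag b \<partial>cnormal_diag v)"
      by (subst nn_P) simp_all
    also have "\<dots> = (\<integral>\<^sup>+x. (\<Prod>i\<in>UNIV. \<integral>\<^sup>+z. indicator (A i) (x $ i + z) \<partial>cnormal (b i)) \<partial>cnormal_diag v)"
      unfolding cnormal_diag_eq_vec_measure
      by (intro nn_integral_cong nn_integral_vec_measure_prod prob_space_cnormal less_imp_le b) simp_all
    also have "\<dots> = (\<Prod>i\<in>UNIV. \<integral>\<^sup>+x. \<integral>\<^sup>+z. indicator (A i) (x + z) \<partial>cnormal (b i) \<partial>cnormal (v i))"
      unfolding cnormal_diag_eq_vec_measure
    proof (intro nn_integral_vec_measure_prod prob_space_cnormal v)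
      fix i
      interpret prob_space "cnormal (b i)" by (intro prob_space_cnormal less_imp_le b)
      show "(\<lambda>x. \<integral>\<^sup>+z. indicator (A i) (x + z) \<partial>cnormal (b i)) \<in> borel_measurable borel"
        by measurable
    qed simp
    also have "\<dots> = (\<Prod>i\<in>UNIV. emeasure (cnormal (v i + b i)) (A i))"
    proof (rule prod.cong[OF refl])
      fix i
      show "(\<integral>\<^sup>+x. \<integral>\<^sup>+z. indicator (A i) (x + z) \<partial>cnormal (b i) \<partial>cnormal (v i)) = emeasure (cnormal (v i + b i)) (A i)"
        using nn_integral_cnormal_add[OF v[of i] b[of i], of "indicator (A i)" 1] by (simp add: add.commute)
    qed
    finally show "(\<integral>\<^sup>+x. (\<Prod>i\<in>UNIV. indicator (A i) (x $ i)) \<partial>P) = (\<Prod>i\<in>UNIV. emeasure (cnormal (v i + b i)) (A i))" .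
  qed (simp_all add: P_def prob_space_cnormal v b less_imp_le add_nonneg_nonneg)
  with nn_P[of f] show ?thesis by simp
qed

text \<open>Coordinates are absorbed into the scalar Gaussian one at a time by
  \<open>nn_integral_cnormal_add\<close>. The summand of variance b keeps the accumulated variance
  positive even where \<open>h i\<close> or \<open>v i\<close> vanishes.\<close>

lemma nn_integral_cnormal_diag_functional_add:
  assumes v: "\<And>i. 0 \<le> v i" and b: "0 < b" and [measurable]: "f \<in> borel_measurable borel"
  shows "(\<integral>\<^sup>+x. \<integral>\<^sup>+z. f ((\<Sum>i\<in>UNIV. h i * x $ i) + z) \<partial>cnormal b \<partial>cnormal_diag v) =
    (\<integral>\<^sup>+z. f z \<partial>cnormal (b + (\<Sum>i\<in>UNIV. (cmod (h i))\<^sup>2 * v i)))"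
proof -
  interpret product_sigma_finite "\<lambda>i. cnormal (v i)"
    by (intro product_sigma_finite.intro prob_space_imp_sigma_finite prob_space_cnormal v)
  interpret B: prob_space "cnormal b" by (intro prob_space_cnormal less_imp_le b)
  have "(\<integral>\<^sup>+x. \<integral>\<^sup>+z. f ((\<Sum>i\<in>I. h i * x i) + z) \<partial>cnormal b \<partial>(\<Pi>\<^sub>M i\<in>I. cnormal (v i))) =
    (\<integral>\<^sup>+z. f z \<partial>cnormal (b + (\<Sum>i\<in>I. (cmod (h i))\<^sup>2 * v i)))" if "finite I" for I
    using that \<open>f \<in> borel_measurable borel\<close>
  \<comment> \<open>The function is generalized because the new coordinate enters the induction
    hypothesis as a shift of f.\<close>
  proof (induction I arbitrary: f)
    case empty
    interpret E: prob_space "\<Pi>\<^sub>M i\<in>{}. cnormal (v i)"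
      by (intro prob_space_PiM prob_space_cnormal v)
    show ?case by (simp add: E.emeasure_space_1)
  next
    case (insert i I)
    note [measurable] = insert.prems
    have pos: "0 < b + (\<Sum>i\<in>I. (cmod (h i))\<^sup>2 * v i)" 
      using b v by (intro add_pos_nonneg sum_nonneg) simp_all
    interpret I: prob_space "\<Pi>\<^sub>M i\<in>I. cnormal (v i)"
      by (intro prob_space_PiM prob_space_cnormal v)
    interpret vi: prob_space "cnormal (v i)"
      by (intro prob_space_cnormal v)
    interpret Ii: pair_prob_space "\<Pi>\<^sub>M i\<in>I. cnormal (v i)" "cnormal (v i)" ..
    have upd: "(\<Sum>j\<in>I. h j * (x(i := y)) j) = (\<Sum>j\<in>I. h j * x j)" for x y
      using insert.hyps by (intro sum.cong) auto
    have "(\<integral>\<^sup>+x. \<integral>\<^sup>+z. f ((\<Sum>j\<in>insert i I. h j * x j) + z) \<partial>cnormal b \<partial>(\<Pi>\<^sub>M i\<in>insert i I. cnormal (v i))) =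
      (\<integral>\<^sup>+x. \<integral>\<^sup>+y. \<integral>\<^sup>+z. f ((\<Sum>j\<in>insert i I. h j * (x(i := y)) j) + z) \<partial>cnormal b \<partial>cnormal (v i) \<partial>(\<Pi>\<^sub>M i\<in>I. cnormal (v i)))"
      using insert.hyps by (intro product_nn_integral_insert) measurable
    also have "\<dots> = (\<integral>\<^sup>+x. \<integral>\<^sup>+y. \<integral>\<^sup>+z. f (h i * y + ((\<Sum>j\<in>I. h j * x j) + z)) \<partial>cnormal b \<partial>cnormal (v i) \<partial>(\<Pi>\<^sub>M i\<in>I. cnormal (v i)))"
      by (simp only: sum.insert[OF insert.hyps] upd fun_upd_same add.assoc)
    also have "\<dots> = (\<integral>\<^sup>+y. \<integral>\<^sup>+x. \<integral>\<^sup>+z. f (h i * y + ((\<Sum>j\<in>I. h j * x j) + z)) \<partial>cnormal b \<partial>(\<Pi>\<^sub>M i\<in>I. cnormal (v i)) \<partial>cnormal (v i))"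
      by (rule Ii.Fubini'[symmetric]) measurable
    also have "\<dots> = (\<integral>\<^sup>+y. \<integral>\<^sup>+z. f (h i * y + z) \<partial>cnormal (b + (\<Sum>i\<in>I. (cmod (h i))\<^sup>2 * v i)) \<partial>cnormal (v i))"
    proof (rule nn_integral_cong)
      fix y
      show "(\<integral>\<^sup>+x. \<integral>\<^sup>+z. f (h i * y + ((\<Sum>j\<in>I. h j * x j) + z)) \<partial>cnormal b \<partial>(\<Pi>\<^sub>M i\<in>I. cnormal (v i))) =
        (\<integral>\<^sup>+z. f (h i * y + z) \<partial>cnormal (b + (\<Sum>i\<in>I. (cmod (h i))\<^sup>2 * v i)))"
        using insert.IH[of "\<lambda>z. f (h i * y + z)"] by simp
    qed
    also have "\<dots> = (\<integral>\<^sup>+z. f z \<partial>cnormal (b + (\<Sum>i\<in>insert i I. (cmod (h i))\<^sup>2 * v i)))"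
      unfolding sum.insert[OF insert.hyps]
      by (subst nn_integral_cnormal_add[OF v pos]) (simp_all add: add_ac)
    finally show ?case .
  qed
  from this[of UNIV] show ?thesis
    unfolding cnormal_diag_def by (subst nn_integral_distr) simp_all
qed

section \<open>Translates of a Gaussian law\<close>

text \<open>Cameron-Martin formula: the exponential is the ratio of the density centred at c to the
  density centred at 0.\<close>

lemma nn_integral_cnormal_shift:
  assumes v: "0 < v" and [measurable]: "f \<in> borel_measurable borel"
  shows "(\<integral>\<^sup>+z. f (z + c) \<partial>cnormal v) =
    (\<integral>\<^sup>+z. ennreal (exp ((2 * (c \<bullet> z) - (cmod c)\<^sup>2) / v)) * f z \<partial>cnormal v)"
proof -
  have "(\<integral>\<^sup>+z. f (z + c) \<partial>cnormal v) = (\<integral>\<^sup>+z. ennreal (cnormal_density v (z - c)) * f z \<partial>lborel)"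
    using nn_integral_lborel_shift[of "\<lambda>z. ennreal (cnormal_density v (z - c)) * f z" c] v
    by (simp add: nn_integral_cnormal)
  also have "\<dots> = (\<integral>\<^sup>+z. ennreal (cnormal_density v z) * (ennreal (exp ((2 * (c \<bullet> z) - (cmod c)\<^sup>2) / v)) * f z) \<partial>lborel)"
  proof (rule nn_integral_cong)
    fix z
    have "(cmod (z - c))\<^sup>2 = (cmod z)\<^sup>2 - (2 * (c \<bullet> z) - (cmod c)\<^sup>2)"
      by (simp add: power2_norm_eq_inner inner_diff inner_commute)
    then have "- (cmod (z - c))\<^sup>2 / v = - (cmod z)\<^sup>2 / v + (2 * (c \<bullet> z) - (cmod c)\<^sup>2) / v"
      by (simp add: diff_divide_distrib)
    then have "cnormal_density v (z - c) = cnormal_density v z * exp ((2 * (c \<bullet> z) - (cmod c)\<^sup>2) / v)"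
      by (simp only: cnormal_density_def exp_add) simp
    then show "ennreal (cnormal_density v (z - c)) * f z =
      ennreal (cnormal_density v z) * (ennreal (exp ((2 * (c \<bullet> z) - (cmod c)\<^sup>2) / v)) * f z)"
      using v by (simp add: ennreal_mult cnormal_density_pos less_imp_le mult.assoc)
  qed
  finally show ?thesis using v by (simp add: nn_integral_cnormal)
qed

text \<open>The translated and the exponentially tilted law both have independent components, and by
  the scalar formula these have the same laws.\<close>

lemma nn_integral_cnormal_diag_shift:
  assumes v: "\<And>i. 0 < v i" and [measurable]: "f \<in> borel_measurable borel"
  shows "(\<integral>\<^sup>+x. f (x + c) \<partial>cnormal_diag v) =
    (\<integral>\<^sup>+x. ennreal (exp (\<Sum>i\<in>UNIV. (2 * (c $ i \<bullet> x $ i) - (cmod (c $ i))\<^sup>2) / v i)) * f x \<partial>cnormal_diag v)"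
proof -
  let ?e = "\<lambda>i z. ennreal (exp ((2 * (c $ i \<bullet> z) - (cmod (c $ i))\<^sup>2) / v i))"
  let ?E = "\<lambda>x. ennreal (exp (\<Sum>i\<in>UNIV. (2 * (c $ i \<bullet> x $ i) - (cmod (c $ i))\<^sup>2) / v i))"
  define \<mu> where "\<mu> i = distr (cnormal (v i)) borel (\<lambda>z. z + c $ i)" for i
  note prob_v = prob_space_cnormal[OF less_imp_le[OF v]]
  have prob: "prob_space (\<mu> i)" for i
    unfolding \<mu>_def by (rule prob_space.prob_space_distr[OF prob_v]) simp
  have sets_\<mu>: "sets (\<mu> i) = sets borel" for i by (simp add: \<mu>_def)
  have emeasure_\<mu>: "emeasure (\<mu> i) A = (\<integral>\<^sup>+z. indicator A (z + c $ i) \<partial>cnormal (v i))"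
    if [measurable]: "A \<in> sets borel" for i A
  proof -
    have "emeasure (\<mu> i) A = (\<integral>\<^sup>+z. indicator A z \<partial>\<mu> i)" by (simp add: sets_\<mu>)
    then show ?thesis unfolding \<mu>_def by (subst (asm) nn_integral_distr) simp_all
  qed
  have "distr (cnormal_diag v) borel (\<lambda>x. x + c) = vec_measure \<mu>"
  proof (rule vec_measure_eqI[OF prob sets_\<mu>])
    fix A :: "'a \<Rightarrow> complex set" assume [measurable]: "\<And>i. A i \<in> sets borel"
    have "(\<integral>\<^sup>+x. (\<Prod>i\<in>UNIV. indicator (A i) (x $ i)) \<partial>distr (cnormal_diag v) borel (\<lambda>x. x + c)) =
      (\<integral>\<^sup>+x. (\<Prod>i\<in>UNIV. indicator (A i) (x $ i + c $ i)) \<partial>cnormal_diag v)"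
      by (subst nn_integral_distr) simp_all
    also have "\<dots> = (\<Prod>i\<in>UNIV. \<integral>\<^sup>+z. indicator (A i) (z + c $ i) \<partial>cnormal (v i))"
      unfolding cnormal_diag_eq_vec_measure
      by (rule nn_integral_vec_measure_prod) (simp_all add: prob_v)
    finally show "(\<integral>\<^sup>+x. (\<Prod>i\<in>UNIV. indicator (A i) (x $ i)) \<partial>distr (cnormal_diag v) borel (\<lambda>x. x + c)) =
      (\<Prod>i\<in>UNIV. emeasure (\<mu> i) (A i))" by (simp add: emeasure_\<mu>)
  qed simp
  moreover have "density (cnormal_diag v) ?E = vec_measure \<mu>"
  proof (rule vec_measure_eqI[OF prob sets_\<mu>])
    fix A :: "'a \<Rightarrow> complex set" assume [measurable]: "\<And>i. A i \<in> sets borel"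
    have "(\<integral>\<^sup>+x. (\<Prod>i\<in>UNIV. indicator (A i) (x $ i)) \<partial>density (cnormal_diag v) ?E) =
      (\<integral>\<^sup>+x. (\<Prod>i\<in>UNIV. ?e i (x $ i) * indicator (A i) (x $ i)) \<partial>cnormal_diag v)"
      by (subst nn_integral_density) (simp_all add: exp_sum prod_ennreal[symmetric] prod.distrib)
    also have "\<dots> = (\<Prod>i\<in>UNIV. \<integral>\<^sup>+z. ?e i z * indicator (A i) z \<partial>cnormal (v i))"
      unfolding cnormal_diag_eq_vec_measure
      by (rule nn_integral_vec_measure_prod) (simp_all add: prob_v)
    also have "\<dots> = (\<Prod>i\<in>UNIV. emeasure (\<mu> i) (A i))"
      by (intro prod.cong refl) (simp add: emeasure_\<mu> nn_integral_cnormal_shift[OF v])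
    finally show "(\<integral>\<^sup>+x. (\<Prod>i\<in>UNIV. indicator (A i) (x $ i)) \<partial>density (cnormal_diag v) ?E) =
      (\<Prod>i\<in>UNIV. emeasure (\<mu> i) (A i))" .
  qed simp
  ultimately have "(\<integral>\<^sup>+x. f x \<partial>distr (cnormal_diag v) borel (\<lambda>x. x + c)) = (\<integral>\<^sup>+x. f x \<partial>density (cnormal_diag v) ?E)"
    by simp
  then show ?thesis
    by (subst (asm) nn_integral_distr, simp_all, subst (asm) nn_integral_density, simp_all)
qed

text \<open>If \<open>e\<close> has independent components of variances \<open>v i\<close>, then \<open>\<Sum>i. cnj (h i) * e i / v i\<close> is a
  sufficient statistic for the scale of the direction \<open>h\<close>: resampling the scale of that direction
  with the variance \<open>1 / g\<close> does not change the law of \<open>e\<close>.\<close>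

lemma nn_integral_cnormal_diag_resample:
  fixes h :: "complex ^ 'n::finite"
  assumes v: "\<And>i. 0 < v i" and [measurable]: "F \<in> borel_measurable borel"
    and g_def: "g = (\<Sum>i\<in>UNIV. (cmod (h $ i))\<^sup>2 / v i)" and g: "0 < g"
    and m_def: "m = (\<lambda>e. (\<Sum>i\<in>UNIV. cnj (h $ i) * e $ i / of_real (v i)))"
  shows "(\<integral>\<^sup>+e. \<integral>\<^sup>+t. F (e - (m e / of_real g) *s h + t *s h) \<partial>cnormal (1 / g) \<partial>cnormal_diag v) =
    (\<integral>\<^sup>+e. F e \<partial>cnormal_diag v)"
proof -
  interpret V: prob_space "cnormal_diag v" by (intro prob_space_cnormal_diag less_imp_le v)
  interpret VL: pair_sigma_finite "cnormal_diag v" "lborel :: complex measure" ..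
  have [measurable]: "m \<in> borel_measurable borel" unfolding m_def by measurable
  \<comment> \<open>Moving e along h by \<open>\<tau>\<close> changes \<open>m e / of_real g\<close>
    by exactly \<open>\<tau>\<close>, so this quotient reads off the coefficient of h.\<close>
  have m_add: "m (e + \<tau> *s h) = m e + of_real g * \<tau>" for e \<tau>
  proof -
    have "cnj (h $ i) * (e $ i + \<tau> * h $ i) / of_real (v i) =
      cnj (h $ i) * e $ i / of_real (v i) + of_real ((cmod (h $ i))\<^sup>2 / v i) * \<tau>" for i
      using complex_norm_square[of "h $ i"] by (simp add: add_divide_distrib algebra_simps)
    then show ?thesis by (simp add: m_def g_def sum.distrib sum_distrib_right)
  qed
  \<comment> \<open>For translations along h the Cameron-Martin exponent depends on e only through
    \<open>m e\<close>: this is the sufficiency of m.\<close>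
  have shift_exp: "(\<Sum>i\<in>UNIV. (2 * ((\<tau> *s h) $ i \<bullet> e $ i) - (cmod ((\<tau> *s h) $ i))\<^sup>2) / v i) =
    2 * (\<tau> \<bullet> m e) - (cmod \<tau>)\<^sup>2 * g" for \<tau> e
  proof -
    have "(2 * ((\<tau> *s h) $ i \<bullet> e $ i) - (cmod ((\<tau> *s h) $ i))\<^sup>2) / v i =
      2 * (\<tau> \<bullet> (cnj (h $ i) * e $ i / of_real (v i))) - (cmod \<tau>)\<^sup>2 * ((cmod (h $ i))\<^sup>2 / v i)" for i
    proof -
      have "(\<tau> * h $ i) \<bullet> e $ i = \<tau> \<bullet> (cnj (h $ i) * e $ i)"
        by (simp add: inner_complex_def algebra_simps)
      moreover have "\<tau> \<bullet> (z / of_real (v i)) = (\<tau> \<bullet> z) / v i" for z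
        by (simp add: inner_complex_def add_divide_distrib)
      ultimately show ?thesis by (simp add: norm_mult power_mult_distrib diff_divide_distrib)
    qed
    then show ?thesis
      by (simp add: m_def g_def sum_subtractf sum_distrib_left inner_sum_right)
  qed
  \<comment> \<open>The variance \<open>1 / g\<close> is that of \<open>m e / of_real g\<close>:
    component i contributes \<open>(cmod (h $ i))\<^sup>2 / v i\<close> to the variance of
    \<open>m e\<close>, which therefore equals g.\<close>
  let ?\<phi> = "\<lambda>z. ennreal (cnormal_density (1 / g) z)"
  have \<phi>_mult: "?\<phi> (m e / of_real g) * ennreal (exp (2 * (\<tau> \<bullet> m e) - (cmod \<tau>)\<^sup>2 * g)) = ?\<phi> (\<tau> - m e / of_real g)"
    for e \<tau>
  proof -
    have norm_diff: "(cmod (\<tau> - m e / of_real g))\<^sup>2 = (cmod \<tau>)\<^sup>2 - 2 * (\<tau> \<bullet> m e) / g + (cmod (m e / of_real g))\<^sup>2"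
      by (simp add: power2_norm_eq_inner inner_diff inner_commute)
         (simp add: inner_complex_def add_divide_distrib algebra_simps)
    have "- (cmod (\<tau> - m e / of_real g))\<^sup>2 / (1 / g) =
      - (cmod (m e / of_real g))\<^sup>2 / (1 / g) + (2 * (\<tau> \<bullet> m e) - (cmod \<tau>)\<^sup>2 * g)"
      unfolding norm_diff using g by (simp add: field_simps)
    then have "cnormal_density (1 / g) (\<tau> - m e / of_real g) =
      cnormal_density (1 / g) (m e / of_real g) * exp (2 * (\<tau> \<bullet> m e) - (cmod \<tau>)\<^sup>2 * g)"
      by (simp only: cnormal_density_def exp_add) simp
    then show ?thesis using g by (simp add: ennreal_mult cnormal_density_pos less_imp_le)
  qed
  \<comment> \<open>With \<open>t = \<tau> + m e / of_real g\<close> the resampled vector becomes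
    the translate \<open>e + \<tau> *s h\<close>. At fixed \<open>\<tau>\<close> the Cameron-Martin
    formula undoes the translation, and the density left over has mass 1 in
    \<open>\<tau>\<close>.\<close>
  have "(\<integral>\<^sup>+e. \<integral>\<^sup>+t. F (e - (m e / of_real g) *s h + t *s h) \<partial>cnormal (1 / g) \<partial>cnormal_diag v) =
    (\<integral>\<^sup>+e. \<integral>\<^sup>+\<tau>. ?\<phi> (\<tau> + m e / of_real g) * F (e + \<tau> *s h) \<partial>lborel \<partial>cnormal_diag v)"
  proof (rule nn_integral_cong)
    fix e
    have "(\<integral>\<^sup>+t. F (e - (m e / of_real g) *s h + t *s h) \<partial>cnormal (1 / g)) =
      (\<integral>\<^sup>+t. ?\<phi> t * F (e + (t - m e / of_real g) *s h) \<partial>lborel)"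
      using g by (subst nn_integral_cnormal) (simp_all add: vector_ssub_ldistrib vector_sub_rdistrib algebra_simps)
    also have "\<dots> = (\<integral>\<^sup>+\<tau>. ?\<phi> (\<tau> + m e / of_real g) * F (e + \<tau> *s h) \<partial>lborel)"
      using nn_integral_lborel_shift[of "\<lambda>t. ?\<phi> t * F (e + (t - m e / of_real g) *s h)" "m e / of_real g"] by simp
    finally show "(\<integral>\<^sup>+t. F (e - (m e / of_real g) *s h + t *s h) \<partial>cnormal (1 / g)) =
      (\<integral>\<^sup>+\<tau>. ?\<phi> (\<tau> + m e / of_real g) * F (e + \<tau> *s h) \<partial>lborel)" .
  qed
  also have "\<dots> = (\<integral>\<^sup>+\<tau>. \<integral>\<^sup>+e. ?\<phi> (\<tau> + m e / of_real g) * F (e + \<tau> *s h) \<partial>cnormal_diag v \<partial>lborel)"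
    by (rule VL.Fubini'[symmetric]) measurable
  also have "\<dots> = (\<integral>\<^sup>+\<tau>. \<integral>\<^sup>+e. ?\<phi> (\<tau> - m e / of_real g) * F e \<partial>cnormal_diag v \<partial>lborel)"
  proof (rule nn_integral_cong)
    fix \<tau>
    have "(\<integral>\<^sup>+e. ?\<phi> (\<tau> + m e / of_real g) * F (e + \<tau> *s h) \<partial>cnormal_diag v) =
      (\<integral>\<^sup>+e. ?\<phi> (m (e + \<tau> *s h) / of_real g) * F (e + \<tau> *s h) \<partial>cnormal_diag v)"
      using g by (simp add: m_add add_divide_distrib add.commute)
    also have "\<dots> = (\<integral>\<^sup>+e. ennreal (exp (2 * (\<tau> \<bullet> m e) - (cmod \<tau>)\<^sup>2 * g)) * (?\<phi> (m e / of_real g) * F e) \<partial>cnormal_diag v)"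
      unfolding shift_exp[symmetric] by (rule nn_integral_cnormal_diag_shift[OF v]) measurable
    also have "\<dots> = (\<integral>\<^sup>+e. ?\<phi> (\<tau> - m e / of_real g) * F e \<partial>cnormal_diag v)"
      by (simp only: \<phi>_mult[symmetric] mult_ac)
    finally show "(\<integral>\<^sup>+e. ?\<phi> (\<tau> + m e / of_real g) * F (e + \<tau> *s h) \<partial>cnormal_diag v) =
      (\<integral>\<^sup>+e. ?\<phi> (\<tau> - m e / of_real g) * F e \<partial>cnormal_diag v)" .
  qed
  also have "\<dots> = (\<integral>\<^sup>+e. \<integral>\<^sup>+\<tau>. ?\<phi> (\<tau> - m e / of_real g) * F e \<partial>lborel \<partial>cnormal_diag v)"
    by (rule VL.Fubini') measurable
  also have "\<dots> = (\<integral>\<^sup>+e. F e \<partial>cnormal_diag v)"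
  proof (rule nn_integral_cong)
    fix e
    have "(\<integral>\<^sup>+\<tau>. ?\<phi> (\<tau> - m e / of_real g) \<partial>lborel) = 1"
      using nn_integral_lborel_shift[of ?\<phi> "- (m e / of_real g)"] nn_integral_cnormal_density[of "1 / g"] g by simp
    then show "(\<integral>\<^sup>+\<tau>. ?\<phi> (\<tau> - m e / of_real g) * F e \<partial>lborel) = F e"
      by (subst nn_integral_multc) simp_all
  qed
  finally show ?thesis .
qed

section \<open>Mutual information for one realization\<close>

lemma distr_eqI_nn_integral:
  assumes [measurable]: "X \<in> M \<rightarrow>\<^sub>M K" "Y \<in> N \<rightarrow>\<^sub>M K"
    and eq: "\<And>g. g \<in> borel_measurable K \<Longrightarrow> (\<integral>\<^sup>+\<omega>. g (X \<omega>) \<partial>M) = (\<integral>\<^sup>+\<omega>. g (Y \<omega>) \<partial>N)"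
  shows "distr M K X = distr N K Y"
proof (rule measure_eqI)
  fix A assume "A \<in> sets (distr M K X)"
  then have [measurable]: "A \<in> sets K" by simp
  have "emeasure (distr M K X) A = (\<integral>\<^sup>+x. indicator A x \<partial>distr M K X)" by simp
  also have "\<dots> = (\<integral>\<^sup>+\<omega>. indicator A (X \<omega>) \<partial>M)" by (rule nn_integral_distr) measurable
  also have "\<dots> = (\<integral>\<^sup>+\<omega>. indicator A (Y \<omega>) \<partial>N)" by (rule eq) measurable
  also have "\<dots> = (\<integral>\<^sup>+x. indicator A x \<partial>distr N K Y)" by (rule nn_integral_distr[symmetric]) measurable
  finally show "emeasure (distr M K X) A = emeasure (distr N K Y) A" by simp
qed simp

lemma nn_integral_pair5:
  assumes "prob_space B" "prob_space C" "prob_space D" "prob_space E"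
    and g: "g \<in> borel_measurable (A \<Otimes>\<^sub>M B \<Otimes>\<^sub>M C \<Otimes>\<^sub>M D \<Otimes>\<^sub>M E)"
  shows "(\<integral>\<^sup>+\<omega>. g \<omega> \<partial>(A \<Otimes>\<^sub>M B \<Otimes>\<^sub>M C \<Otimes>\<^sub>M D \<Otimes>\<^sub>M E)) =
    (\<integral>\<^sup>+a. \<integral>\<^sup>+b. \<integral>\<^sup>+c. \<integral>\<^sup>+d. \<integral>\<^sup>+e. g (a, b, c, d, e) \<partial>E \<partial>D \<partial>C \<partial>B \<partial>A)"
proof -
  interpret B: prob_space B by fact
  interpret C: prob_space C by fact
  interpret D: prob_space D by fact
  interpret E: prob_space E by fact
  interpret DE: pair_prob_space D E ..
  interpret CDE: pair_prob_space C "D \<Otimes>\<^sub>M E" ..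
  interpret BCDE: pair_prob_space B "C \<Otimes>\<^sub>M D \<Otimes>\<^sub>M E" ..
  note [measurable] = g
  show ?thesis
    by (subst BCDE.nn_integral_fst[symmetric], simp, intro nn_integral_cong,
        subst CDE.nn_integral_fst[symmetric], simp, intro nn_integral_cong,
        subst DE.nn_integral_fst[symmetric], simp, intro nn_integral_cong,
        subst E.nn_integral_fst[symmetric], simp_all)
qed

text \<open>In the uplink this is the signal-to-noise ratio after whitening and maximum-ratio
  combining, when only base station distortion and thermal noise disturb a signal of power
  p.\<close>

definition channel_gain :: "real \<Rightarrow> real \<Rightarrow> real \<Rightarrow> complex ^ 'n::finite \<Rightarrow> real" where
  "channel_gain \<kappa> \<sigma>2 p h = (\<Sum>i\<in>UNIV. (cmod (h $ i))\<^sup>2 / (\<kappa> * (cmod (h $ i))\<^sup>2 + \<sigma>2 / p))"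

lemma channel_gain_nonneg: "0 < \<kappa> \<Longrightarrow> 0 < \<sigma>2 \<Longrightarrow> 0 < p \<Longrightarrow> 0 \<le> channel_gain \<kappa> \<sigma>2 p h"
  unfolding channel_gain_def by (intro sum_nonneg divide_nonneg_nonneg add_nonneg_nonneg) simp_all

text \<open>With the scalar part t of variance \<open>1 / g\<close> split off, the coefficient of h
  is d plus the transmitter distortion plus t: a scalar channel of noise variance
  \<open>1 / g + \<kappa>t * p\<close>. The remainder is independent of this noise, so it may be
  disclosed as side information and no optimal receiver has to be identified.\<close>

lemma ul_mutual_information_le:
  fixes h :: "complex ^ 'n::finite"
  assumes f: "prob_space f" and sets_f [measurable_cong]: "sets f = sets borel"
    and power: "(\<integral>\<^sup>+d. ennreal ((cmod d)\<^sup>2) \<partial>f) \<le> ennreal p"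
    and J: "prob_space J" and sets_J [measurable_cong]: "sets J = sets borel"
    and \<kappa>r: "0 < \<kappa>r" and \<kappa>t: "0 \<le> \<kappa>t" and \<sigma>2: "0 < \<sigma>2" and p: "0 < p"
  shows "ul_mutual_information \<kappa>t \<kappa>r \<sigma>2 p J h f \<le>
    log 2 (1 + channel_gain \<kappa>r \<sigma>2 p h / (1 + \<kappa>t * channel_gain \<kappa>r \<sigma>2 p h))"
proof -
  let ?A = "cnormal (\<kappa>t * p)" and ?B = "cnormal_diag (\<lambda>i. \<kappa>r * p * (cmod (h $ i))\<^sup>2)"
    and ?S = "cnormal_diag (\<lambda>i. \<sigma>2) :: (complex ^ 'n) measure"
  define v where "v i = \<kappa>r * p * (cmod (h $ i))\<^sup>2 + \<sigma>2" for i
  have v: "0 < v i" for i unfolding v_def using \<kappa>r p \<sigma>2 by (intro add_nonneg_pos) simp_all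
  define g where "g = (\<Sum>i\<in>UNIV. (cmod (h $ i))\<^sup>2 / v i)"
  define U where "U = ul_joint \<kappa>t \<kappa>r \<sigma>2 p J h f"
  let ?Z = "\<lambda>(d, \<eta>t, \<eta>r, noise, interf). (d + \<eta>t) *s h + \<eta>r + (noise + interf)"
  have gain: "channel_gain \<kappa>r \<sigma>2 p h = p * g"
  proof -
    have "(cmod (h $ i))\<^sup>2 / (\<kappa>r * (cmod (h $ i))\<^sup>2 + \<sigma>2 / p) = p * ((cmod (h $ i))\<^sup>2 / v i)" for i
    proof -
      have "v i = p * (\<kappa>r * (cmod (h $ i))\<^sup>2 + \<sigma>2 / p)" using p by (simp add: v_def algebra_simps)
      then show ?thesis using p by simp
    qed
    then show ?thesis by (simp add: channel_gain_def g_def sum_distrib_left)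
  qed
  interpret f: prob_space f by fact
  interpret J: prob_space J by fact
  interpret A: prob_space ?A using \<kappa>t p by (intro prob_space_cnormal) simp
  interpret B: prob_space ?B using \<kappa>r p by (intro prob_space_cnormal_diag) simp
  interpret S: prob_space ?S using \<sigma>2 by (intro prob_space_cnormal_diag) simp
  interpret SJ: pair_prob_space ?S J ..
  interpret BSJ: pair_prob_space ?B "?S \<Otimes>\<^sub>M J" ..
  interpret R: pair_prob_space ?A "?B \<Otimes>\<^sub>M ?S \<Otimes>\<^sub>M J" ..
  interpret fR: pair_prob_space f "?A \<Otimes>\<^sub>M ?B \<Otimes>\<^sub>M ?S \<Otimes>\<^sub>M J" ..
  have U_eq: "U = f \<Otimes>\<^sub>M ?A \<Otimes>\<^sub>M ?B \<Otimes>\<^sub>M ?S \<Otimes>\<^sub>M J"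
    by (simp add: U_def ul_joint_def)
  have [measurable_cong]: "sets U = sets (borel \<Otimes>\<^sub>M borel \<Otimes>\<^sub>M borel \<Otimes>\<^sub>M borel \<Otimes>\<^sub>M borel)"
    unfolding U_eq by (intro sets_pair_measure_cong) (simp_all add: sets_f sets_J)
  have prob_U: "prob_space U" unfolding U_eq by unfold_locales
  have MI: "ul_mutual_information \<kappa>t \<kappa>r \<sigma>2 p J h f = prob_space.mutual_information U 2 borel borel fst ?Z"
    unfolding ul_mutual_information_def U_def[symmetric]
    by (rule arg_cong2[where f="prob_space.mutual_information U 2 borel borel"]) (auto simp: fun_eq_iff)
  have g0: "0 \<le> g" unfolding g_def by (intro sum_nonneg divide_nonneg_pos v) simp
  show ?thesis
  proof (cases "g = 0")
    \<comment> \<open>Resampling divides by g, so the zero channel is treated apart: its output does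
      not contain d, and the constant ratio 1 bounds the mutual information by 0.\<close>
    case True
    then have "(cmod (h $ i))\<^sup>2 / v i = 0" for i
      unfolding g_def by (subst (asm) sum_nonneg_eq_0_iff) (auto simp: v less_imp_le)
    then have h: "h = 0" using v by (simp add: vec_eq_iff less_imp_neq[THEN not_sym])
    interpret information_space U 2 using prob_U by (simp add: information_space_def information_space_axioms_def)
    let ?F = "\<lambda>(\<eta>t :: complex, \<eta>r, noise, interf). \<eta>r + (noise + interf) :: complex ^ 'n"
    let ?R = "?A \<Otimes>\<^sub>M ?B \<Otimes>\<^sub>M ?S \<Otimes>\<^sub>M J"
    have distr_f: "distr U borel fst = f"
    proof -
      have "distr U borel fst = distr U f fst" by (rule distr_cong) (simp_all add: sets_f)
      then show ?thesis unfolding U_eq by (simp add: R.distr_pair_fst)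
    qed
    have "mutual_information 2 borel borel fst (\<lambda>\<omega>. ?F (snd \<omega>)) \<le> 0"
    proof (rule mutual_information_le_expectation_log[where U = ?R and \<nu> = ?R and a = "\<lambda>_. 1"])
      have "distr U (borel \<Otimes>\<^sub>M ?R) (\<lambda>\<omega>. (fst \<omega>, snd \<omega>)) = U"
        unfolding U_eq by (simp, rule distr_id2) (intro sets_pair_measure_cong, simp_all add: sets_f)
      then show "distr U (borel \<Otimes>\<^sub>M ?R) (\<lambda>\<omega>. (fst \<omega>, snd \<omega>)) = density (distr U borel fst \<Otimes>\<^sub>M ?R) (\<lambda>p. ennreal 1)"
        unfolding distr_f by (simp add: density_1 U_eq)
      show "prob_space ?R" by unfold_locales
    qed (simp_all add: U_eq)
    moreover have "(\<lambda>\<omega>. ?F (snd \<omega>)) = ?Z" by (auto simp: h fun_eq_iff)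
    ultimately show ?thesis unfolding MI gain True by simp
  next
    case False
    then have g: "0 < g" using g0 by simp
    define m where "m = (\<lambda>e :: complex ^ 'n. (\<Sum>i\<in>UNIV. cnj (h $ i) * e $ i / of_real (v i)))"
    have [measurable]: "m \<in> borel_measurable borel" unfolding m_def by measurable
    let ?V = "cnormal_diag v" and ?T = "cnormal (1 / g)"
    define N where "N = 1 / g + \<kappa>t * p"
    have N: "0 < N" unfolding N_def using g \<kappa>t p by (intro add_pos_nonneg) simp_all
    interpret V: prob_space ?V by (intro prob_space_cnormal_diag less_imp_le v)
    interpret T: prob_space ?T using g by (intro prob_space_cnormal) simp
    interpret C: prob_space "cnormal N" using N by (intro prob_space_cnormal) simp
    interpret TV: pair_prob_space ?T ?V ..
    interpret VJ: pair_prob_space ?V J ..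
    interpret CVJ: pair_prob_space "cnormal N" "?V \<Otimes>\<^sub>M J" ..
    interpret fCVJ: pair_prob_space f "cnormal N \<Otimes>\<^sub>M ?V \<Otimes>\<^sub>M J" ..
    let ?U' = "f \<Otimes>\<^sub>M cnormal N \<Otimes>\<^sub>M ?V \<Otimes>\<^sub>M J"
    let ?F = "\<lambda>(s, e, j). s *s h + (e - (m e / of_real g) *s h) + j"
    let ?Z' = "\<lambda>(d, n, w). ?F (d + n, w)"
    have [measurable_cong]: "sets ?U' = sets (borel \<Otimes>\<^sub>M borel \<Otimes>\<^sub>M borel \<Otimes>\<^sub>M borel)"
      by (intro sets_pair_measure_cong) (simp_all add: sets_f sets_J)
    have [measurable_cong]: "sets (?V \<Otimes>\<^sub>M J) = sets (borel \<Otimes>\<^sub>M borel)"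
      by (intro sets_pair_measure_cong) (simp_all add: sets_J)
    have Z [measurable]: "?Z \<in> U \<rightarrow>\<^sub>M borel" by measurable
    have Z' [measurable]: "?Z' \<in> ?U' \<rightarrow>\<^sub>M borel" by measurable
    have "distr U (borel \<Otimes>\<^sub>M borel) (\<lambda>\<omega>. (fst \<omega>, ?Z \<omega>)) = distr ?U' (borel \<Otimes>\<^sub>M borel) (\<lambda>\<omega>. (fst \<omega>, ?Z' \<omega>))"
    proof (rule distr_eqI_nn_integral)
      fix G :: "complex \<times> (complex ^ 'n) \<Rightarrow> ennreal" assume [measurable]: "G \<in> borel_measurable (borel \<Otimes>\<^sub>M borel)"
      \<comment> \<open>Averaging over the interference first leaves a test function of the input
        and one vector, to which the Gaussian identities apply.\<close>
      define H where "H d z = (\<integral>\<^sup>+j. G (d, z + j) \<partial>J)" for d z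
      have [measurable]: "case_prod H \<in> borel_measurable (borel \<Otimes>\<^sub>M borel)"
        unfolding H_def by measurable
      have [measurable]: "H d \<in> borel_measurable borel" for d
        unfolding H_def by measurable
      have "(\<integral>\<^sup>+\<omega>. G (fst \<omega>, ?Z \<omega>) \<partial>U) =
        (\<integral>\<^sup>+d. \<integral>\<^sup>+\<eta>. \<integral>\<^sup>+r. \<integral>\<^sup>+k. \<integral>\<^sup>+j. G (d, (d + \<eta>) *s h + r + (k + j)) \<partial>J \<partial>?S \<partial>?B \<partial>?A \<partial>f)"
      proof -
        have "(\<lambda>\<omega>. G (fst \<omega>, ?Z \<omega>)) \<in> borel_measurable U" by measurable
        from nn_integral_pair5[OF A.prob_space_axioms B.prob_space_axioms S.prob_space_axioms J.prob_space_axioms this[unfolded U_eq]]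
        show ?thesis unfolding U_eq by simp
      qed
      also have "\<dots> = (\<integral>\<^sup>+d. \<integral>\<^sup>+\<eta>. \<integral>\<^sup>+r. \<integral>\<^sup>+k. H d ((d + \<eta>) *s h + (r + k)) \<partial>?S \<partial>?B \<partial>?A \<partial>f)"
        by (simp add: H_def add.assoc)
      also have "\<dots> = (\<integral>\<^sup>+d. \<integral>\<^sup>+\<eta>. \<integral>\<^sup>+e. H d ((d + \<eta>) *s h + e) \<partial>?V \<partial>?A \<partial>f)"
      proof (intro nn_integral_cong)
        fix d \<eta>
        show "(\<integral>\<^sup>+r. \<integral>\<^sup>+k. H d ((d + \<eta>) *s h + (r + k)) \<partial>?S \<partial>?B) = (\<integral>\<^sup>+e. H d ((d + \<eta>) *s h + e) \<partial>?V)"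
          unfolding v_def
          by (rule nn_integral_cnormal_diag_add[of _ _ "\<lambda>e. H d ((d + \<eta>) *s h + e)"]) (use \<kappa>r p \<sigma>2 in simp_all)
      qed
      \<comment> \<open>The resampled t is integrated outside e, so that it can join
        \<open>\<eta>\<close>. The factor \<open>1 *\<close> matches the shape
        \<open>h * w + z\<close> in \<open>nn_integral_cnormal_add\<close>.\<close>
      also have "\<dots> = (\<integral>\<^sup>+d. \<integral>\<^sup>+\<eta>. \<integral>\<^sup>+t. \<integral>\<^sup>+e. H d ((d + (1 * \<eta> + t)) *s h + (e - (m e / of_real g) *s h)) \<partial>?V \<partial>?T \<partial>?A \<partial>f)"
      proof (rule nn_integral_cong, rule nn_integral_cong)
        fix d \<eta>
        have "(\<integral>\<^sup>+e. H d ((d + \<eta>) *s h + e) \<partial>?V) =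
          (\<integral>\<^sup>+e. \<integral>\<^sup>+t. H d ((d + \<eta>) *s h + (e - (m e / of_real g) *s h + t *s h)) \<partial>?T \<partial>?V)"
          by (rule nn_integral_cnormal_diag_resample[OF v _ g_def g m_def, symmetric]) measurable
        also have "\<dots> = (\<integral>\<^sup>+t. \<integral>\<^sup>+e. H d ((d + \<eta>) *s h + (e - (m e / of_real g) *s h + t *s h)) \<partial>?V \<partial>?T)"
          by (rule TV.Fubini') measurable
        finally show "(\<integral>\<^sup>+e. H d ((d + \<eta>) *s h + e) \<partial>?V) =
          (\<integral>\<^sup>+t. \<integral>\<^sup>+e. H d ((d + (1 * \<eta> + t)) *s h + (e - (m e / of_real g) *s h)) \<partial>?V \<partial>?T)"
          by (simp add: vector_sadd_rdistrib algebra_simps)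
      qed
      also have "\<dots> = (\<integral>\<^sup>+d. \<integral>\<^sup>+n. \<integral>\<^sup>+e. H d ((d + n) *s h + (e - (m e / of_real g) *s h)) \<partial>?V \<partial>cnormal N \<partial>f)"
      proof (rule nn_integral_cong)
        fix d
        show "(\<integral>\<^sup>+\<eta>. \<integral>\<^sup>+t. \<integral>\<^sup>+e. H d ((d + (1 * \<eta> + t)) *s h + (e - (m e / of_real g) *s h)) \<partial>?V \<partial>?T \<partial>?A) =
          (\<integral>\<^sup>+n. \<integral>\<^sup>+e. H d ((d + n) *s h + (e - (m e / of_real g) *s h)) \<partial>?V \<partial>cnormal N)"
          using nn_integral_cnormal_add[of "\<kappa>t * p" "1 / g" "\<lambda>n. \<integral>\<^sup>+e. H d ((d + n) *s h + (e - (m e / of_real g) *s h)) \<partial>?V" 1]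
            \<kappa>t p g by (simp add: N_def)
      qed
      also have "\<dots> = (\<integral>\<^sup>+d. \<integral>\<^sup>+n. \<integral>\<^sup>+w. G (d, ?F (d + n, w)) \<partial>(?V \<Otimes>\<^sub>M J) \<partial>cnormal N \<partial>f)"
        by (intro nn_integral_cong, subst J.nn_integral_fst[symmetric]) (simp_all add: H_def add.assoc)
      also have "\<dots> = (\<integral>\<^sup>+d. \<integral>\<^sup>+q. G (d, ?Z' (d, q)) \<partial>(cnormal N \<Otimes>\<^sub>M ?V \<Otimes>\<^sub>M J) \<partial>f)"
        by (rule nn_integral_cong, subst VJ.nn_integral_fst[symmetric]) simp_all
      also have "\<dots> = (\<integral>\<^sup>+\<omega>. G (fst \<omega>, ?Z' \<omega>) \<partial>?U')"
        by (subst CVJ.nn_integral_fst[symmetric]) simp_all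
      finally show "(\<integral>\<^sup>+\<omega>. G (fst \<omega>, ?Z \<omega>) \<partial>U) = (\<integral>\<^sup>+\<omega>. G (fst \<omega>, ?Z' \<omega>) \<partial>?U')" .
    qed measurable
    then have "prob_space.mutual_information U 2 borel borel fst ?Z = prob_space.mutual_information ?U' 2 borel borel fst ?Z'"
      by (intro mutual_information_cong_joint_law prob_U fCVJ.P.prob_space_axioms Z Z') measurable
    also have "\<dots> \<le> log 2 (1 + p / N)"
      by (rule gaussian_mutual_information_le[where u = "\<lambda>d. d" and F = ?F])
        (use f VJ.P.prob_space_axioms sets_f N p power in simp_all)
    also have "p / N = p * g / (1 + \<kappa>t * (p * g))"
      unfolding N_def using g by (simp add: field_simps)
    finally show ?thesis unfolding MI gain .
  qed
qed

section \<open>Second moments of the downlink signal\<close>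

lemma power2_norm_vec: "(norm x)\<^sup>2 = (\<Sum>i\<in>UNIV. (norm (x $ i))\<^sup>2)"
  by (simp add: norm_vec_def L2_set_def sum_nonneg)

context
  fixes f :: "(complex ^ 'n::finite) measure" and p :: real
  assumes f: "prob_space f" and sets_f [measurable_cong]: "sets f = sets borel"
    and power: "(\<integral>\<^sup>+s. ennreal ((norm s)\<^sup>2) \<partial>f) \<le> ennreal p" and p: "0 < p"
begin

lemma integrable_signal_norm2: "integrable f (\<lambda>s. (norm s)\<^sup>2)"
  using power by (intro integrableI_nonneg) (auto simp: top_unique le_less_trans)

lemma integrable_signal_component: "integrable f (\<lambda>s. (cmod (s $ i))\<^sup>2)"
  by (rule Bochner_Integration.integrable_bound[OF integrable_signal_norm2])
    (simp_all add: power_mono Finite_Cartesian_Product.norm_nth_le)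

text \<open>The entries of \<open>signal_corr\<close> are Bochner integrals, which would be 0 for a
  non-integrable product; their identification with signal powers rests on this fact.\<close>

lemma integrable_signal_product: "integrable f (\<lambda>s. s $ i * cnj (s $ j))"
proof (rule Bochner_Integration.integrable_bound[OF integrable_signal_norm2])
  have "cmod (s $ i * cnj (s $ j)) \<le> (norm s)\<^sup>2" for s
    unfolding norm_mult complex_mod_cnj power2_eq_square by (intro mult_mono Finite_Cartesian_Product.norm_nth_le) simp_all
  then show "AE s in f. norm (s $ i * cnj (s $ j)) \<le> norm ((norm s)\<^sup>2)" by simp
  have [measurable]: "cnj \<in> borel_measurable borel"
    by (intro borel_measurable_continuous_onI continuous_intros)
  show "(\<lambda>s. s $ i * cnj (s $ j)) \<in> borel_measurable f" by measurable
qed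

lemma signal_corr_diag: "Re (signal_corr f $ i $ i) = (\<integral>s. (cmod (s $ i))\<^sup>2 \<partial>f)"
proof -
  have "signal_corr f $ i $ i = (\<integral>s. of_real ((cmod (s $ i))\<^sup>2) \<partial>f)"
    by (simp add: signal_corr_def complex_norm_square del: of_real_power)
  then show ?thesis by (simp del: of_real_power)
qed

lemma signal_corr_trace_le: "(\<Sum>i\<in>UNIV. Re (signal_corr f $ i $ i)) \<le> p"
proof -
  have "(\<Sum>i\<in>UNIV. Re (signal_corr f $ i $ i)) = (\<integral>s. (norm s)\<^sup>2 \<partial>f)"
    by (simp add: signal_corr_diag power2_norm_vec integrable_signal_component)
  also have "\<dots> \<le> p"
    using power p by (subst (asm) nn_integral_eq_integral) (simp_all add: integrable_signal_norm2)
  finally show ?thesis .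
qed

text \<open>Turns the form in \<open>signal_corr f\<close> that sets the receiver distortion
  variance of \<open>dl_joint\<close> into the mean received power, the quantity needed for
  \<open>gaussian_mutual_information_le\<close>.\<close>

lemma signal_corr_form:
  fixes h :: "complex ^ 'n"
  defines "u \<equiv> \<lambda>s :: complex ^ 'n. \<Sum>i\<in>UNIV. h $ i * s $ i"
  shows integrable_signal_functional: "integrable f (\<lambda>s. (cmod (u s))\<^sup>2)"
    and signal_corr_form_eq: "Re (\<Sum>i\<in>UNIV. \<Sum>j\<in>UNIV. h $ i * signal_corr f $ i $ j * cnj (h $ j)) = (\<integral>s. (cmod (u s))\<^sup>2 \<partial>f)"
proof -
  have eq: "of_real ((cmod (u s))\<^sup>2) = (\<Sum>i\<in>UNIV. \<Sum>j\<in>UNIV. h $ i * (s $ i * cnj (s $ j)) * cnj (h $ j))" for s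
    unfolding u_def complex_norm_square
    by (simp add: sum_product cnj_sum mult_ac)
  have "integrable f (\<lambda>s. \<Sum>i\<in>UNIV. \<Sum>j\<in>UNIV. h $ i * (s $ i * cnj (s $ j)) * cnj (h $ j))"
    by (intro Bochner_Integration.integrable_sum integrable_mult_left integrable_mult_right integrable_signal_product)
  then have "integrable f (\<lambda>s. complex_of_real ((cmod (u s))\<^sup>2))" by (simp only: eq)
  then show "integrable f (\<lambda>s. (cmod (u s))\<^sup>2)" by (simp only: complex_of_real_integrable_eq)
  have "(\<integral>s. complex_of_real ((cmod (u s))\<^sup>2) \<partial>f) = (\<Sum>i\<in>UNIV. \<Sum>j\<in>UNIV. h $ i * signal_corr f $ i $ j * cnj (h $ j))"
    unfolding eq signal_corr_def
    by (subst Bochner_Integration.integral_sum, simp add: integrable_signal_product,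
        intro sum.cong refl,
        subst Bochner_Integration.integral_sum, simp add: integrable_signal_product)
      (simp add: integrable_signal_product)
  then show "Re (\<Sum>i\<in>UNIV. \<Sum>j\<in>UNIV. h $ i * signal_corr f $ i $ j * cnj (h $ j)) = (\<integral>s. (cmod (u s))\<^sup>2 \<partial>f)"
    by (metis integral_complex_of_real Re_complex_of_real)
qed

text \<open>Cauchy-Schwarz, before taking expectations, with the denominators of
  \<open>channel_gain\<close> as weights, so that one factor is the gain. In the other factor, the
  part \<open>\<sigma>2 / p\<close> of the weights costs at most \<open>\<sigma>2\<close> by the
  trace constraint, and the remaining part yields the transmitter distortion power.\<close>

lemma signal_power_le_channel_gain:
  fixes h :: "complex ^ 'n"
  assumes \<kappa>: "0 < \<kappa>" and \<sigma>2: "0 < \<sigma>2"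
  shows "(\<integral>s. (cmod (\<Sum>i\<in>UNIV. h $ i * s $ i))\<^sup>2 \<partial>f) \<le>
    channel_gain \<kappa> \<sigma>2 p h * (\<kappa> * (\<Sum>i\<in>UNIV. (cmod (h $ i))\<^sup>2 * Re (signal_corr f $ i $ i)) + \<sigma>2)"
proof -
  define c where "c i = \<kappa> * (cmod (h $ i))\<^sup>2 + \<sigma>2 / p" for i
  have c: "0 < c i" for i unfolding c_def using \<kappa> \<sigma>2 p by (intro add_nonneg_pos) simp_all
  let ?g = "channel_gain \<kappa> \<sigma>2 p h"
  have g: "?g = (\<Sum>i\<in>UNIV. (cmod (h $ i))\<^sup>2 / c i)" by (simp add: channel_gain_def c_def)
  have pointwise: "(cmod (\<Sum>i\<in>UNIV. h $ i * s $ i))\<^sup>2 \<le> ?g * (\<Sum>i\<in>UNIV. c i * (cmod (s $ i))\<^sup>2)" for s :: "complex ^ 'n"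
  proof -
    have "cmod (\<Sum>i\<in>UNIV. h $ i * s $ i) \<le> (\<Sum>i\<in>UNIV. cmod (h $ i * s $ i))" by (rule norm_sum)
    also have "\<dots> = (\<Sum>i\<in>UNIV. (cmod (h $ i) / sqrt (c i)) * (sqrt (c i) * cmod (s $ i)))"
      using c by (intro sum.cong refl) (simp add: norm_mult less_imp_neq[THEN not_sym])
    finally have "(cmod (\<Sum>i\<in>UNIV. h $ i * s $ i))\<^sup>2 \<le> (\<Sum>i\<in>UNIV. (cmod (h $ i) / sqrt (c i)) * (sqrt (c i) * cmod (s $ i)))\<^sup>2"
      by (intro power_mono) simp_all
    also have "\<dots> \<le> (\<Sum>i\<in>UNIV. (cmod (h $ i) / sqrt (c i))\<^sup>2) * (\<Sum>i\<in>UNIV. (sqrt (c i) * cmod (s $ i))\<^sup>2)"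
      by (rule Cauchy_Schwarz_ineq_sum)
    also have "\<dots> = ?g * (\<Sum>i\<in>UNIV. c i * (cmod (s $ i))\<^sup>2)"
      using c by (simp add: g power_divide power_mult_distrib less_imp_le)
    finally show ?thesis .
  qed
  have "(\<integral>s. (cmod (\<Sum>i\<in>UNIV. h $ i * s $ i))\<^sup>2 \<partial>f) \<le> (\<integral>s. ?g * (\<Sum>i\<in>UNIV. c i * (cmod (s $ i))\<^sup>2) \<partial>f)"
    by (rule integral_mono) (simp_all add: integrable_signal_functional integrable_signal_component pointwise)
  also have "\<dots> = ?g * (\<Sum>i\<in>UNIV. c i * Re (signal_corr f $ i $ i))"
    by (simp add: integrable_signal_component signal_corr_diag)
  also have "(\<Sum>i\<in>UNIV. c i * Re (signal_corr f $ i $ i)) =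
    \<kappa> * (\<Sum>i\<in>UNIV. (cmod (h $ i))\<^sup>2 * Re (signal_corr f $ i $ i)) + \<sigma>2 / p * (\<Sum>i\<in>UNIV. Re (signal_corr f $ i $ i))"
    by (simp add: c_def distrib_right sum.distrib sum_distrib_left mult.assoc)
  also have "?g * \<dots> \<le> ?g * (\<kappa> * (\<Sum>i\<in>UNIV. (cmod (h $ i))\<^sup>2 * Re (signal_corr f $ i $ i)) + \<sigma>2)"
  proof (intro mult_left_mono add_left_mono channel_gain_nonneg \<kappa> \<sigma>2 p)
    have "\<sigma>2 / p * (\<Sum>i\<in>UNIV. Re (signal_corr f $ i $ i)) \<le> \<sigma>2 / p * p"
      using \<sigma>2 p by (intro mult_left_mono signal_corr_trace_le) simp
    then show "\<sigma>2 / p * (\<Sum>i\<in>UNIV. Re (signal_corr f $ i $ i)) \<le> \<sigma>2" using p by simp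
  qed
  finally show ?thesis .
qed

text \<open>Both distortions and the thermal noise merge into one scalar Gaussian. Its variance N
  depends on the input law, so the ratio of received power Q to N has to be bounded uniformly over
  the admissible laws.\<close>

lemma dl_mutual_information_le:
  fixes h :: "complex ^ 'n"
  assumes J: "prob_space J" and sets_J [measurable_cong]: "sets J = sets borel"
    and \<kappa>t: "0 < \<kappa>t" and \<kappa>r: "0 \<le> \<kappa>r" and \<sigma>2: "0 < \<sigma>2"
  shows "dl_mutual_information \<kappa>t \<kappa>r \<sigma>2 J h f \<le>
    log 2 (1 + channel_gain \<kappa>t \<sigma>2 p h / (1 + \<kappa>r * channel_gain \<kappa>t \<sigma>2 p h))"
proof -
  define w where "w i = Re (signal_corr f $ i $ i)" for i
  define u where "u s = (\<Sum>i\<in>UNIV. h $ i * s $ i)" for s :: "complex ^ 'n"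
  define Q where "Q = (\<integral>s. (cmod (u s))\<^sup>2 \<partial>f)"
  have w: "0 \<le> w i" for i by (simp add: w_def signal_corr_diag)
  have Q: "0 \<le> Q" by (simp add: Q_def)
  have [measurable]: "u \<in> borel_measurable borel" unfolding u_def by measurable
  \<comment> \<open>Receiver distortion and thermal noise are collected first: N1 is positive,
    whereas the transmitter distortion seen through h may vanish.\<close>
  define N1 where "N1 = \<sigma>2 + \<kappa>r * Q"
  define N where "N = N1 + (\<Sum>i\<in>UNIV. (cmod (h $ i))\<^sup>2 * (\<kappa>t * w i))"
  have N1: "0 < N1" unfolding N1_def using \<sigma>2 \<kappa>r Q by (intro add_pos_nonneg) simp_all
  have N: "0 < N" unfolding N_def using N1 \<kappa>t w by (intro add_pos_nonneg sum_nonneg) simp_all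
  let ?A = "cnormal_diag (\<lambda>i. \<kappa>t * w i)" and ?B = "cnormal (\<kappa>r * Q)" and ?S = "cnormal \<sigma>2"
  define U where "U = dl_joint \<kappa>t \<kappa>r \<sigma>2 J h f"
  let ?Z = "\<lambda>(s, \<eta>t, \<eta>r, noise, interf). (\<Sum>i\<in>UNIV. h $ i * (s $ i + \<eta>t $ i)) + \<eta>r + (noise + interf)"
  interpret f: prob_space f by (rule f)
  interpret J: prob_space J by fact
  interpret A: prob_space ?A using \<kappa>t w by (intro prob_space_cnormal_diag) simp
  interpret B: prob_space ?B using \<kappa>r Q by (intro prob_space_cnormal) simp
  interpret S: prob_space ?S using \<sigma>2 by (intro prob_space_cnormal) simp
  interpret N1: prob_space "cnormal N1" using N1 by (intro prob_space_cnormal) simp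
  interpret C: prob_space "cnormal N" using N by (intro prob_space_cnormal) simp
  interpret SJ: pair_prob_space ?S J ..
  interpret BSJ: pair_prob_space ?B "?S \<Otimes>\<^sub>M J" ..
  interpret R: pair_prob_space ?A "?B \<Otimes>\<^sub>M ?S \<Otimes>\<^sub>M J" ..
  interpret fR: pair_prob_space f "?A \<Otimes>\<^sub>M ?B \<Otimes>\<^sub>M ?S \<Otimes>\<^sub>M J" ..
  interpret CJ: pair_prob_space "cnormal N" J ..
  interpret fCJ: pair_prob_space f "cnormal N \<Otimes>\<^sub>M J" ..
  have U_eq: "U = f \<Otimes>\<^sub>M ?A \<Otimes>\<^sub>M ?B \<Otimes>\<^sub>M ?S \<Otimes>\<^sub>M J"
    by (simp add: U_def dl_joint_def Let_def w_def Q_def u_def signal_corr_form_eq del: Re_sum)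
  have [measurable_cong]: "sets U = sets (borel \<Otimes>\<^sub>M borel \<Otimes>\<^sub>M borel \<Otimes>\<^sub>M borel \<Otimes>\<^sub>M borel)"
    unfolding U_eq by (intro sets_pair_measure_cong) (simp_all add: sets_f sets_J)
  have prob_U: "prob_space U" unfolding U_eq by unfold_locales
  have MI: "dl_mutual_information \<kappa>t \<kappa>r \<sigma>2 J h f = prob_space.mutual_information U 2 borel borel fst ?Z"
    unfolding dl_mutual_information_def U_def[symmetric]
    by (rule arg_cong2[where f="prob_space.mutual_information U 2 borel borel"]) (auto simp: fun_eq_iff)
  let ?U' = "f \<Otimes>\<^sub>M cnormal N \<Otimes>\<^sub>M J"
  let ?F = "\<lambda>(v, j). v + j"
  let ?Z' = "\<lambda>(s, n, j). ?F (u s + n, j)"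
  have [measurable_cong]: "sets ?U' = sets (borel \<Otimes>\<^sub>M borel \<Otimes>\<^sub>M borel)"
    by (intro sets_pair_measure_cong) (simp_all add: sets_f sets_J)
  have Z [measurable]: "?Z \<in> U \<rightarrow>\<^sub>M borel" by measurable
  have Z' [measurable]: "?Z' \<in> ?U' \<rightarrow>\<^sub>M borel" by measurable
  have "distr U (borel \<Otimes>\<^sub>M borel) (\<lambda>\<omega>. (fst \<omega>, ?Z \<omega>)) = distr ?U' (borel \<Otimes>\<^sub>M borel) (\<lambda>\<omega>. (fst \<omega>, ?Z' \<omega>))"
  proof (rule distr_eqI_nn_integral)
    fix G :: "(complex ^ 'n) \<times> complex \<Rightarrow> ennreal" assume [measurable]: "G \<in> borel_measurable (borel \<Otimes>\<^sub>M borel)"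
    define H where "H s z = (\<integral>\<^sup>+j. G (s, z + j) \<partial>J)" for s z
    have [measurable]: "case_prod H \<in> borel_measurable (borel \<Otimes>\<^sub>M borel)"
      unfolding H_def by measurable
    have [measurable]: "H s \<in> borel_measurable borel" for s
      unfolding H_def by measurable
    have "(\<integral>\<^sup>+\<omega>. G (fst \<omega>, ?Z \<omega>) \<partial>U) =
      (\<integral>\<^sup>+s. \<integral>\<^sup>+\<eta>. \<integral>\<^sup>+r. \<integral>\<^sup>+k. \<integral>\<^sup>+j. G (s, (\<Sum>i\<in>UNIV. h $ i * (s $ i + \<eta> $ i)) + r + (k + j)) \<partial>J \<partial>?S \<partial>?B \<partial>?A \<partial>f)"
    proof -
      have "(\<lambda>\<omega>. G (fst \<omega>, ?Z \<omega>)) \<in> borel_measurable U" by measurable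
      from nn_integral_pair5[OF A.prob_space_axioms B.prob_space_axioms S.prob_space_axioms J.prob_space_axioms this[unfolded U_eq]]
      show ?thesis unfolding U_eq by simp
    qed
    also have "\<dots> = (\<integral>\<^sup>+s. \<integral>\<^sup>+\<eta>. \<integral>\<^sup>+r. \<integral>\<^sup>+k. H s ((u s + (\<Sum>i\<in>UNIV. h $ i * \<eta> $ i)) + (1 * r + k)) \<partial>?S \<partial>?B \<partial>?A \<partial>f)"
      by (simp add: H_def u_def distrib_left sum.distrib add.assoc)
    also have "\<dots> = (\<integral>\<^sup>+s. \<integral>\<^sup>+\<eta>. \<integral>\<^sup>+z. H s (u s + ((\<Sum>i\<in>UNIV. h $ i * \<eta> $ i) + z)) \<partial>cnormal N1 \<partial>?A \<partial>f)"
    proof (rule nn_integral_cong, rule nn_integral_cong)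
      fix s \<eta>
      show "(\<integral>\<^sup>+r. \<integral>\<^sup>+k. H s ((u s + (\<Sum>i\<in>UNIV. h $ i * \<eta> $ i)) + (1 * r + k)) \<partial>?S \<partial>?B) =
        (\<integral>\<^sup>+z. H s (u s + ((\<Sum>i\<in>UNIV. h $ i * \<eta> $ i) + z)) \<partial>cnormal N1)"
        using nn_integral_cnormal_add[of "\<kappa>r * Q" \<sigma>2 "\<lambda>z. H s ((u s + (\<Sum>i\<in>UNIV. h $ i * \<eta> $ i)) + z)" 1] \<kappa>r Q \<sigma>2
        by (simp add: N1_def add.assoc)
    qed
    also have "\<dots> = (\<integral>\<^sup>+s. \<integral>\<^sup>+n. H s (u s + n) \<partial>cnormal N \<partial>f)"
      unfolding N_def using \<kappa>t w N1
      by (intro nn_integral_cong nn_integral_cnormal_diag_functional_add) simp_all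
    also have "\<dots> = (\<integral>\<^sup>+s. \<integral>\<^sup>+q. G (s, ?Z' (s, q)) \<partial>(cnormal N \<Otimes>\<^sub>M J) \<partial>f)"
      by (rule nn_integral_cong, subst J.nn_integral_fst[symmetric]) (simp_all add: H_def)
    also have "\<dots> = (\<integral>\<^sup>+\<omega>. G (fst \<omega>, ?Z' \<omega>) \<partial>?U')"
      by (subst CJ.nn_integral_fst[symmetric]) simp_all
    finally show "(\<integral>\<^sup>+\<omega>. G (fst \<omega>, ?Z \<omega>) \<partial>U) = (\<integral>\<^sup>+\<omega>. G (fst \<omega>, ?Z' \<omega>) \<partial>?U')" .
  qed measurable
  then have "prob_space.mutual_information U 2 borel borel fst ?Z = prob_space.mutual_information ?U' 2 borel borel fst ?Z'"
    by (intro mutual_information_cong_joint_law prob_U fCJ.P.prob_space_axioms Z Z') measurable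
  also have "\<dots> \<le> log 2 (1 + Q / N)"
  proof (rule gaussian_mutual_information_le[where u = u and F = ?F])
    show "(\<integral>\<^sup>+s. ennreal ((cmod (u s))\<^sup>2) \<partial>f) \<le> ennreal Q"
      unfolding Q_def u_def by (subst nn_integral_eq_integral) (simp_all add: integrable_signal_functional)
  qed (use f J sets_f N Q in simp_all)
  also have "\<dots> \<le> log 2 (1 + channel_gain \<kappa>t \<sigma>2 p h / (1 + \<kappa>r * channel_gain \<kappa>t \<sigma>2 p h))"
  proof -
    let ?g = "channel_gain \<kappa>t \<sigma>2 p h"
    define E where "E = \<kappa>t * (\<Sum>i\<in>UNIV. (cmod (h $ i))\<^sup>2 * w i) + \<sigma>2"
    have "Q \<le> ?g * E"
      using signal_power_le_channel_gain[OF \<kappa>t \<sigma>2, of h] by (simp add: Q_def u_def E_def w_def)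
    moreover have "N = E + \<kappa>r * Q"
      by (simp add: N_def N1_def E_def sum_distrib_left mult_ac)
    \<comment> \<open>The receiver distortion \<open>\<kappa>r * Q\<close> is itself proportional to
      the signal power. Adding \<open>?g * (\<kappa>r * Q)\<close> to both sides of
      \<open>Q \<le> ?g * E\<close> turns E into N; this is the origin of the saturation
      \<open>?g / (1 + \<kappa>r * ?g)\<close>.\<close>
    ultimately have "Q * (1 + \<kappa>r * ?g) \<le> ?g * N"
      by (simp add: algebra_simps)
    moreover have "0 < 1 + \<kappa>r * ?g"
      using \<kappa>r channel_gain_nonneg[OF \<kappa>t \<sigma>2 p, of h] by (intro add_pos_nonneg) simp_all
    ultimately have "Q / N \<le> ?g / (1 + \<kappa>r * ?g)"
      using N by (simp add: field_simps)
    moreover have "0 < 1 + Q / N" using Q N by (simp add: add_pos_nonneg)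
    ultimately show ?thesis by simp
  qed
  finally show ?thesis unfolding MI .
qed

end

section \<open>Averaging over the channel\<close>

text \<open>The tilted density is again Gaussian up to a factor, with
  \<open>1 / v' = 1 / v + k\<close>; the factor \<open>1 / (1 + k * v)\<close> is the ratio
  \<open>v' / v\<close> of the normalizations.\<close>

lemma nn_integral_cnormal_exp_norm2:
  assumes v: "0 < v" and k: "0 \<le> k"
  shows "(\<integral>\<^sup>+z. ennreal (exp (- k * (cmod z)\<^sup>2)) \<partial>cnormal v) = ennreal (1 / (1 + k * v))"
proof -
  define v' where "v' = v / (1 + k * v)"
  have kv: "0 < 1 + k * v" using v k by (simp add: add_pos_nonneg)
  then have v': "0 < v'" using v by (simp add: v'_def)
  have "(\<integral>\<^sup>+z. ennreal (exp (- k * (cmod z)\<^sup>2)) \<partial>cnormal v) =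
    (\<integral>\<^sup>+z. ennreal (1 / (1 + k * v)) * ennreal (cnormal_density v' z) \<partial>lborel)"
  proof (subst nn_integral_cnormal[OF v], simp, rule nn_integral_cong)
    fix z
    have "- (cmod z)\<^sup>2 / v + - k * (cmod z)\<^sup>2 = - (cmod z)\<^sup>2 / v'"
      using v kv by (simp add: v'_def field_simps)
    then have "exp (- (cmod z)\<^sup>2 / v) * exp (- k * (cmod z)\<^sup>2) = exp (- (cmod z)\<^sup>2 / v')"
      by (simp only: mult_exp_exp)
    moreover have "1 / (pi * v) = 1 / (1 + k * v) * (1 / (pi * v'))"
      using v kv by (simp add: v'_def)
    ultimately have "cnormal_density v z * exp (- k * (cmod z)\<^sup>2) = 1 / (1 + k * v) * cnormal_density v' z"
      by (simp add: cnormal_density_def)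
    then show "ennreal (cnormal_density v z) * ennreal (exp (- k * (cmod z)\<^sup>2)) =
      ennreal (1 / (1 + k * v)) * ennreal (cnormal_density v' z)"
      using v v' kv by (simp add: ennreal_mult[symmetric] cnormal_density_pos less_imp_le)
  qed
  then show ?thesis using v' by (simp add: nn_integral_cmult nn_integral_cnormal_density)
qed

text \<open>As a Bochner integral, \<open>E1\<close> would read 0 where the integral diverges. The
  finiteness required here is later deduced from the expectation being computed.\<close>

lemma nn_integral_E1:
  assumes "(\<integral>\<^sup>+t. ennreal (exp (- t * x) / t) * indicator {1..} t \<partial>lborel) < \<infinity>"
  shows "(\<integral>\<^sup>+t. ennreal (exp (- t * x) / t) * indicator {1..} t \<partial>lborel) = ennreal (E1 x)"
proof -
  have "E1 x = enn2real (\<integral>\<^sup>+t. ennreal (indicator {1..} t *\<^sub>R (exp (- t * x) / t)) \<partial>lborel)"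
    unfolding E1_def set_lebesgue_integral_def
    by (rule integral_eq_nn_integral) (auto simp: indicator_def)
  also have "(\<integral>\<^sup>+t. ennreal (indicator {1..} t *\<^sub>R (exp (- t * x) / t)) \<partial>lborel) =
    (\<integral>\<^sup>+t. ennreal (exp (- t * x) / t) * indicator {1..} t \<partial>lborel)"
    by (intro nn_integral_cong) (auto simp: indicator_def)
  finally show ?thesis using assms by simp
qed

text \<open>Writing \<open>1 / (c + \<kappa> |z|\<^sup>2)\<close> as a Laplace transform turns the expectation into one over
  Gaussian integrals.\<close>

lemma nn_integral_cnormal_reciprocal:
  assumes v: "0 < v" and c: "0 < c" and \<kappa>: "0 < \<kappa>"
  defines "x \<equiv> c / (\<kappa> * v)"
  shows "(\<integral>\<^sup>+z. ennreal (c / (c + \<kappa> * (cmod z)\<^sup>2)) \<partial>cnormal v) = ennreal (x * exp x * E1 x)"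
proof -
  have x: "0 < x" using v c \<kappa> by (simp add: x_def)
  interpret C: prob_space "cnormal v" using v by (intro prob_space_cnormal) simp
  interpret CL: pair_sigma_finite "cnormal v" "lborel :: real measure" ..
  have laplace: "(\<integral>\<^sup>+u. ennreal (c * exp (- u * b)) * indicator {0..} u \<partial>lborel) = ennreal (c / b)" if b: "0 < b" for b
  proof -
    have "((\<lambda>u. - (c / b * exp (- u * b))) \<longlongrightarrow> - (c / b * 0)) at_top"
      using b by (intro tendsto_intros) real_asymp
    then have "(\<integral>\<^sup>+u. ennreal (c * exp (- u * b)) * indicator {0..} u \<partial>lborel) =
      ennreal (- (c / b * 0) - - (c / b * exp (- 0 * b)))"
      using b c by (intro nn_integral_FTC_atLeast) (auto intro!: derivative_eq_intros)
    then show ?thesis by simp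
  qed
  have "(\<integral>\<^sup>+z. ennreal (c / (c + \<kappa> * (cmod z)\<^sup>2)) \<partial>cnormal v) =
    (\<integral>\<^sup>+z. \<integral>\<^sup>+u. ennreal (c * exp (- u * (c + \<kappa> * (cmod z)\<^sup>2))) * indicator {0..} u \<partial>lborel \<partial>cnormal v)"
    using c \<kappa> by (intro nn_integral_cong laplace[symmetric] add_pos_nonneg) simp_all
  also have "\<dots> = (\<integral>\<^sup>+u. \<integral>\<^sup>+z. ennreal (c * exp (- u * (c + \<kappa> * (cmod z)\<^sup>2))) * indicator {0..} u \<partial>cnormal v \<partial>lborel)"
    by (rule CL.Fubini'[symmetric]) measurable
  also have "\<dots> = (\<integral>\<^sup>+u. ennreal (c * exp (- u * c) / (1 + u * \<kappa> * v)) * indicator {0..} u \<partial>lborel)"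
  proof (rule nn_integral_cong)
    fix u :: real
    show "(\<integral>\<^sup>+z. ennreal (c * exp (- u * (c + \<kappa> * (cmod z)\<^sup>2))) * indicator {0..} u \<partial>cnormal v) =
      ennreal (c * exp (- u * c) / (1 + u * \<kappa> * v)) * indicator {0..} u"
    proof (cases "0 \<le> u")
      case True
      have "(\<integral>\<^sup>+z. ennreal (c * exp (- u * (c + \<kappa> * (cmod z)\<^sup>2))) \<partial>cnormal v) =
        (\<integral>\<^sup>+z. ennreal (c * exp (- u * c)) * ennreal (exp (- (u * \<kappa>) * (cmod z)\<^sup>2)) \<partial>cnormal v)"
        using c by (intro nn_integral_cong) (simp add: ennreal_mult[symmetric] mult_exp_exp algebra_simps)
      also have "\<dots> = ennreal (c * exp (- u * c)) * ennreal (1 / (1 + u * \<kappa> * v))"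
        using True \<kappa> nn_integral_cnormal_exp_norm2[OF v, of "u * \<kappa>"] by (subst nn_integral_cmult) simp_all
      finally show ?thesis using True c \<kappa> v by (simp add: ennreal_mult[symmetric])
    qed simp
  qed
  \<comment> \<open>Substitution \<open>t = 1 + u * \<kappa> * v\<close>: it carries
    \<open>u \<ge> 0\<close> to \<open>t \<ge> 1\<close>, turns the denominator into t, and splits
    \<open>- u * c\<close> as \<open>x - t * x\<close>, whence the factor
    \<open>exp x\<close>.\<close>
  also have "\<dots> = ennreal \<bar>1 / (\<kappa> * v)\<bar> * (\<integral>\<^sup>+t. ennreal (c * exp (- (- (1 / (\<kappa> * v)) + 1 / (\<kappa> * v) * t) * c) / (1 + (- (1 / (\<kappa> * v)) + 1 / (\<kappa> * v) * t) * \<kappa> * v)) *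
      indicator {0..} (- (1 / (\<kappa> * v)) + 1 / (\<kappa> * v) * t) \<partial>lborel)"
    using \<kappa> v by (intro nn_integral_real_affine) simp_all
  also have "\<dots> = ennreal (1 / (\<kappa> * v)) * (\<integral>\<^sup>+t. ennreal (c * exp x) * (ennreal (exp (- t * x) / t) * indicator {1..} t) \<partial>lborel)"
  proof -
    have eq: "ennreal (c * exp (- (- (1 / (\<kappa> * v)) + 1 / (\<kappa> * v) * t) * c) / (1 + (- (1 / (\<kappa> * v)) + 1 / (\<kappa> * v) * t) * \<kappa> * v)) *
      indicator {0..} (- (1 / (\<kappa> * v)) + 1 / (\<kappa> * v) * t) = ennreal (c * exp x) * (ennreal (exp (- t * x) / t) * indicator {1..} t)" for t
    proof (cases "1 \<le> t")
      case True
      have 1: "0 \<le> - (1 / (\<kappa> * v)) + 1 / (\<kappa> * v) * t" using True \<kappa> v by (simp add: field_simps)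
      have 2: "1 + (- (1 / (\<kappa> * v)) + 1 / (\<kappa> * v) * t) * \<kappa> * v = t" using \<kappa> v by (simp add: field_simps)
      have 3: "- (- (1 / (\<kappa> * v)) + 1 / (\<kappa> * v) * t) * c = x + - t * x" by (simp add: x_def algebra_simps)
      show ?thesis unfolding 2 3 exp_add using 1 True c by (simp add: ennreal_mult[symmetric] mult.assoc)
    next
      case False
      then have "\<not> 0 \<le> - (1 / (\<kappa> * v)) + 1 / (\<kappa> * v) * t" using \<kappa> v by (simp add: field_simps)
      then show ?thesis using False by simp
    qed
    show ?thesis unfolding eq using \<kappa> v by simp
  qed
  also have "\<dots> = ennreal (x * exp x) * (\<integral>\<^sup>+t. ennreal (exp (- t * x) / t) * indicator {1..} t \<partial>lborel)"
    using c \<kappa> v by (subst nn_integral_cmult) (simp_all add: mult.assoc[symmetric] ennreal_mult[symmetric] x_def)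
  finally have eq: "(\<integral>\<^sup>+z. ennreal (c / (c + \<kappa> * (cmod z)\<^sup>2)) \<partial>cnormal v) =
    ennreal (x * exp x) * (\<integral>\<^sup>+t. ennreal (exp (- t * x) / t) * indicator {1..} t \<partial>lborel)" .
  \<comment> \<open>The reciprocal is at most 1, so its mean is finite; as \<open>x * exp x\<close>
    is positive, the integral defining \<open>E1 x\<close> is finite too.\<close>
  have "(\<integral>\<^sup>+z. ennreal (c / (c + \<kappa> * (cmod z)\<^sup>2)) \<partial>cnormal v) \<le> (\<integral>\<^sup>+z. 1 \<partial>cnormal v)"
    using c \<kappa> by (intro nn_integral_mono) (simp add: divide_le_eq_1 add_pos_nonneg)
  also have "\<dots> < \<infinity>" using C.emeasure_space_1 by simp
  finally have "(\<integral>\<^sup>+t. ennreal (exp (- t * x) / t) * indicator {1..} t \<partial>lborel) < \<infinity>"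
    unfolding eq using x by (auto simp: ennreal_mult_less_top less_top)
  from nn_integral_E1[OF this] show ?thesis
    unfolding eq using x by (simp add: ennreal_mult')
qed

lemma integral_cnormal_gain:
  assumes v: "0 < v" and c: "0 < c" and \<kappa>: "0 < \<kappa>"
  defines "x \<equiv> c / (\<kappa> * v)"
  shows "integrable (cnormal v) (\<lambda>z. (cmod z)\<^sup>2 / (\<kappa> * (cmod z)\<^sup>2 + c))"
    and "(\<integral>z. (cmod z)\<^sup>2 / (\<kappa> * (cmod z)\<^sup>2 + c) \<partial>cnormal v) = 1 / \<kappa> * (1 - x * exp x * E1 x)"
proof -
  interpret prob_space "cnormal v" using v by (intro prob_space_cnormal) simp
  have x: "0 < x" using v c \<kappa> by (simp add: x_def)
  have E1: "0 \<le> E1 x" unfolding E1_def set_lebesgue_integral_def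
    by (rule Bochner_Integration.integral_nonneg) (auto simp: indicator_def)
  have eq: "(cmod z)\<^sup>2 / (\<kappa> * (cmod z)\<^sup>2 + c) = 1 / \<kappa> * (1 - c / (c + \<kappa> * (cmod z)\<^sup>2))" for z
  proof -
    have "0 < c + \<kappa> * (cmod z)\<^sup>2" using c \<kappa> by (simp add: add_pos_nonneg)
    then show ?thesis using \<kappa> by (simp add: field_simps)
  qed
  have nonneg: "0 \<le> c / (c + \<kappa> * (cmod z)\<^sup>2)" for z
    using c \<kappa> by simp
  have int: "integrable (cnormal v) (\<lambda>z. c / (c + \<kappa> * (cmod z)\<^sup>2))"
    using nn_integral_cnormal_reciprocal[OF v c \<kappa>] nonneg by (intro integrableI_nonneg) simp_all
  have "(\<integral>z. c / (c + \<kappa> * (cmod z)\<^sup>2) \<partial>cnormal v) = x * exp x * E1 x"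
    using nn_integral_cnormal_reciprocal[OF v c \<kappa>, folded x_def] nonneg x E1
    by (subst integral_eq_nn_integral) simp_all
  moreover have "prob UNIV = 1" using prob_space by simp
  ultimately show "integrable (cnormal v) (\<lambda>z. (cmod z)\<^sup>2 / (\<kappa> * (cmod z)\<^sup>2 + c))"
    and "(\<integral>z. (cmod z)\<^sup>2 / (\<kappa> * (cmod z)\<^sup>2 + c) \<partial>cnormal v) = 1 / \<kappa> * (1 - x * exp x * E1 x)"
    unfolding eq using int by simp_all
qed

text \<open>Concavity of the map from gain to rate; the last factor is its derivative at G. The
  slack comes from \<open>ln x \<le> x - 1\<close> and from the discarded term \<open>\<kappa> * (g
  - G)\<^sup>2 / ((1 + \<kappa> * g) * (1 + \<kappa> * G)\<^sup>2)\<close>.\<close>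

lemma log_gain_le_tangent:
  fixes \<kappa> g G :: real
  assumes "0 \<le> \<kappa>" "0 \<le> g" "0 \<le> G"
  shows "log 2 (1 + g / (1 + \<kappa> * g)) \<le>
    log 2 (1 + G / (1 + \<kappa> * G)) + (g - G) * (1 / ((1 + \<kappa> * G)\<^sup>2 * (1 + G / (1 + \<kappa> * G)) * ln 2))"
proof -
  have kg: "0 < 1 + \<kappa> * g" and kG: "0 < 1 + \<kappa> * G" using assms by (simp_all add: add_pos_nonneg)
  define a where "a = 1 + g / (1 + \<kappa> * g)"
  define b where "b = 1 + G / (1 + \<kappa> * G)"
  have a: "0 < a" and b: "0 < b" unfolding a_def b_def using assms kg kG by (simp_all add: add_pos_nonneg)
  have "ln a - ln b = ln (a / b)" using a b by (simp add: ln_div)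
  also have "\<dots> \<le> a / b - 1" using a b by (intro ln_le_minus_one) simp
  also have "\<dots> = (a - b) / b" using b by (simp add: diff_divide_distrib)
  also have "\<dots> \<le> ((g - G) / (1 + \<kappa> * G)\<^sup>2) / b"
  proof (rule divide_right_mono)
    have "a - b = (g - G) / ((1 + \<kappa> * g) * (1 + \<kappa> * G))"
      unfolding a_def b_def using kg kG by (simp add: field_simps)
    also have "\<dots> = (g - G) / (1 + \<kappa> * G)\<^sup>2 - \<kappa> * (g - G)\<^sup>2 / ((1 + \<kappa> * g) * (1 + \<kappa> * G)\<^sup>2)"
    proof -
      have "(g - G) / (P * Q) = (g - G) / Q\<^sup>2 - (P - Q) * (g - G) / (P * Q\<^sup>2)" if "0 < P" "0 < Q" for P Q :: real
        using that by (simp add: field_simps power2_eq_square)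
      from this[OF kg kG] show ?thesis by (simp add: power2_eq_square algebra_simps)
    qed
    also have "\<dots> \<le> (g - G) / (1 + \<kappa> * G)\<^sup>2" using assms kg by simp
    finally show "a - b \<le> (g - G) / (1 + \<kappa> * G)\<^sup>2" .
  qed (use b in simp)
  finally have "ln a \<le> ln b + ((g - G) / (1 + \<kappa> * G)\<^sup>2) / b" by simp
  then have "ln a / ln 2 \<le> (ln b + ((g - G) / (1 + \<kappa> * G)\<^sup>2) / b) / ln 2"
    by (rule divide_right_mono) simp
  then show ?thesis by (simp add: log_def a_def b_def add_divide_distrib)
qed

text \<open>The law is tested against a coordinate vector. The gain is a sum of functions of single
  coordinates, so these marginals determine its mean.\<close>

lemma is_cnormal_component:
  assumes "is_cnormal \<mu> R"
  shows "distr \<mu> borel (\<lambda>x. x $ i) = cnormal (Re (R $ i $ i))"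
proof -
  let ?c = "axis i 1 :: complex ^ 'a"
  have "(\<lambda>x. \<Sum>j\<in>UNIV. cnj (?c $ j) * x $ j) = (\<lambda>x. x $ i)"
    by (simp add: axis_def if_distrib[of cnj] if_distrib[of "\<lambda>z. z * _"] cong: if_cong)
  moreover have "quadratic_form R ?c = R $ i $ i"
    by (simp add: quadratic_form_def axis_def if_distrib[of cnj] if_distrib[of "\<lambda>z. z * _"] if_distrib[of "\<lambda>z. _ * z"] cong: if_cong)
  ultimately show ?thesis using assms unfolding is_cnormal_def by metis
qed

section \<open>Mean of the channel gain and Jensen's inequality\<close>

context
  fixes M :: "'w measure" and X :: "'w \<Rightarrow> complex ^ 'n::finite" and R :: "complex ^ 'n ^ 'n"
    and \<kappa> \<sigma>2 p :: real
  assumes M: "prob_space M" and X [measurable]: "X \<in> borel_measurable M"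
    and law: "is_cnormal (distr M borel X) R" and R: "\<And>i. 0 < Re (R $ i $ i)"
    and \<kappa>: "0 < \<kappa>" and \<sigma>2: "0 < \<sigma>2" and p: "0 < p"
begin

lemma expectation_channel_gain:
  shows "integrable M (\<lambda>\<omega>. channel_gain \<kappa> \<sigma>2 p (X \<omega>))"
    and "(\<integral>\<omega>. channel_gain \<kappa> \<sigma>2 p (X \<omega>) \<partial>M) = G_bound \<kappa> \<sigma>2 p R"
proof -
  have c: "0 < \<sigma>2 / p" using \<sigma>2 p by simp
  let ?f = "\<lambda>z. (cmod z)\<^sup>2 / (\<kappa> * (cmod z)\<^sup>2 + \<sigma>2 / p)"
  have distr_i: "distr M borel (\<lambda>\<omega>. X \<omega> $ i) = cnormal (Re (R $ i $ i))" for i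
    using is_cnormal_component[OF law, of i] by (simp add: distr_distr comp_def)
  have int: "integrable M (\<lambda>\<omega>. ?f (X \<omega> $ i))" for i
    using integral_cnormal_gain(1)[OF R c \<kappa>, of i] unfolding distr_i[symmetric]
    by (subst (asm) integrable_distr_eq) simp_all
  have E: "(\<integral>\<omega>. ?f (X \<omega> $ i) \<partial>M) = (let x = \<sigma>2 / (p * \<kappa> * Re (R $ i $ i)) in 1 / \<kappa> * (1 - x * exp x * E1 x))" for i
    using integral_cnormal_gain(2)[OF R c \<kappa>, of i] unfolding distr_i[symmetric]
    by (subst (asm) integral_distr) (simp_all add: Let_def mult.assoc)
  show "integrable M (\<lambda>\<omega>. channel_gain \<kappa> \<sigma>2 p (X \<omega>))"
    unfolding channel_gain_def by (intro Bochner_Integration.integrable_sum int)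
  show "(\<integral>\<omega>. channel_gain \<kappa> \<sigma>2 p (X \<omega>) \<partial>M) = G_bound \<kappa> \<sigma>2 p R"
    unfolding channel_gain_def G_bound_def
    by (subst Bochner_Integration.integral_sum) (simp_all only: int E)
qed

text \<open>Nonnegativity is inherited from the gain, which spares an estimate of
  \<open>x * exp x * E1 x\<close>.\<close>

lemma G_bound_nonneg: "0 \<le> G_bound \<kappa> \<sigma>2 p R"
  unfolding expectation_channel_gain(2)[symmetric]
  by (intro Bochner_Integration.integral_nonneg channel_gain_nonneg \<kappa> \<sigma>2 p)

text \<open>I stands for the supremum over all input laws at one realization. It is only compared
  pointwise with the tangent at the mean gain, since \<open>nn_integral_mono\<close> applies to
  arbitrary functions.\<close>

lemma capacity_le_capacity_upper:
  assumes \<kappa>': "0 \<le> \<kappa>'"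
    and I: "\<And>\<omega>. \<omega> \<in> space M \<Longrightarrow> I \<omega> \<le> ennreal (log 2 (1 + channel_gain \<kappa> \<sigma>2 p (X \<omega>) / (1 + \<kappa>' * channel_gain \<kappa> \<sigma>2 p (X \<omega>))))"
  shows "ennreal (real Tdata / real Tcoher) * (\<integral>\<^sup>+\<omega>. I \<omega> \<partial>M) \<le> ennreal (capacity_upper Tdata Tcoher \<kappa>' (G_bound \<kappa> \<sigma>2 p R))"
proof -
  interpret prob_space M by (rule M)
  let ?g = "\<lambda>\<omega>. channel_gain \<kappa> \<sigma>2 p (X \<omega>)" and ?G = "G_bound \<kappa> \<sigma>2 p R"
  define s where "s = 1 / ((1 + \<kappa>' * ?G)\<^sup>2 * (1 + ?G / (1 + \<kappa>' * ?G)) * ln 2)"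
  let ?t = "\<lambda>\<omega>. log 2 (1 + ?G / (1 + \<kappa>' * ?G)) + (?g \<omega> - ?G) * s"
  have phi_nonneg: "0 \<le> log 2 (1 + y / (1 + \<kappa>' * y))" if "0 \<le> y" for y
  proof -
    have "0 \<le> y / (1 + \<kappa>' * y)" using that \<kappa>' by simp
    then show ?thesis by (simp add: add_pos_nonneg)
  qed
  have t: "log 2 (1 + ?g \<omega> / (1 + \<kappa>' * ?g \<omega>)) \<le> ?t \<omega>" for \<omega>
    unfolding s_def by (intro log_gain_le_tangent \<kappa>' channel_gain_nonneg \<kappa> \<sigma>2 p G_bound_nonneg)
  \<comment> \<open>The tangent lies above a nonnegative function, so its Bochner and nonnegative
    integrals agree.\<close>
  have t0: "0 \<le> ?t \<omega>" for \<omega>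
    using phi_nonneg[OF channel_gain_nonneg[OF \<kappa> \<sigma>2 p, of "X \<omega>"]] t[of \<omega>] by simp
  have "(\<integral>\<^sup>+\<omega>. I \<omega> \<partial>M) \<le> (\<integral>\<^sup>+\<omega>. ennreal (?t \<omega>) \<partial>M)"
    by (intro nn_integral_mono order_trans[OF I] ennreal_leI t)
  also have "\<dots> = ennreal (\<integral>\<omega>. ?t \<omega> \<partial>M)"
    using t0 expectation_channel_gain(1) by (intro nn_integral_eq_integral) simp_all
  \<comment> \<open>The linear term vanishes because the tangent is taken at the mean.\<close>
  also have "(\<integral>\<omega>. ?t \<omega> \<partial>M) = log 2 (1 + ?G / (1 + \<kappa>' * ?G))"
    using expectation_channel_gain by (simp add: prob_space)
  finally have "ennreal (real Tdata / real Tcoher) * (\<integral>\<^sup>+\<omega>. I \<omega> \<partial>M) \<le>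
    ennreal (real Tdata / real Tcoher) * ennreal (log 2 (1 + ?G / (1 + \<kappa>' * ?G)))"
    by (rule mult_left_mono) simp
  then show ?thesis
    unfolding capacity_upper_def using phi_nonneg[OF G_bound_nonneg] by (simp add: ennreal_mult[symmetric])
qed

end

theorem theorem2:
  fixes M :: "'w measure" and A :: "'a measure" and B :: "'b measure" and C :: "'c measure"
    and H :: "'w \<Rightarrow> 'a" and H_BS :: "'w \<Rightarrow> 'b" and H_UE :: "'w \<Rightarrow> 'c"
    and chan :: "'a \<Rightarrow> complex ^ 'n::finite" and R :: "complex ^ 'n ^ 'n"
    and J_UE :: "'a \<times> 'b \<times> 'c \<Rightarrow> complex measure" and I_UE :: "'a \<Rightarrow> real"
    and J_BS :: "'a \<times> 'b \<times> 'c \<Rightarrow> (complex ^ 'n) measure" and Q_BS :: "'a \<Rightarrow> complex ^ 'n ^ 'n"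
    and \<kappa>tBS \<kappa>rBS \<kappa>tUE \<kappa>rUE \<sigma>2_BS \<sigma>2_UE p_BS p_UE :: real
    and T_coher T_DL T_UL :: nat
  assumes "prob_space M"
    and "H \<in> M \<rightarrow>\<^sub>M A" and "H_BS \<in> M \<rightarrow>\<^sub>M B" and "H_UE \<in> M \<rightarrow>\<^sub>M C"
    and "chan \<in> A \<rightarrow>\<^sub>M borel"
    and "hermitian_psd R" and "\<And>i. 0 < Re (R $ i $ i)"
    and "is_cnormal (distr M borel (\<lambda>\<omega>. chan (H \<omega>))) R"
    and "J_UE \<in> A \<Otimes>\<^sub>M B \<Otimes>\<^sub>M C \<rightarrow>\<^sub>M prob_algebra borel"
    and "\<And>a b c. (a, b, c) \<in> space (A \<Otimes>\<^sub>M B \<Otimes>\<^sub>M C) \<Longrightarrow>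
           integrable (J_UE (a, b, c)) (\<lambda>x. (cmod x)\<^sup>2) \<and>
           (\<integral>x. x \<partial>J_UE (a, b, c)) = 0 \<and> (\<integral>x. (cmod x)\<^sup>2 \<partial>J_UE (a, b, c)) = I_UE a"
    and "J_BS \<in> A \<Otimes>\<^sub>M B \<Otimes>\<^sub>M C \<rightarrow>\<^sub>M prob_algebra borel"
    and "\<And>a b c. (a, b, c) \<in> space (A \<Otimes>\<^sub>M B \<Otimes>\<^sub>M C) \<Longrightarrow>
           integrable (J_BS (a, b, c)) (\<lambda>x. (norm x)\<^sup>2) \<and>
           (\<integral>x. x \<partial>J_BS (a, b, c)) = 0 \<and>
           (\<forall>i j. (\<integral>x. x $ i * cnj (x $ j) \<partial>J_BS (a, b, c)) = Q_BS a $ i $ j)"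
    and "0 < \<kappa>tBS" and "0 < \<kappa>rBS" and "0 \<le> \<kappa>tUE" and "0 \<le> \<kappa>rUE"
    and "0 < \<sigma>2_BS" and "0 < \<sigma>2_UE" and "0 < p_BS" and "0 < p_UE"
    and "0 < T_coher" and "T_DL \<le> T_coher" and "T_UL \<le> T_coher"
  shows "dl_capacity T_DL T_coher M B H H_BS H_UE chan J_UE \<kappa>tBS \<kappa>rUE \<sigma>2_UE p_BS
           \<le> ennreal (capacity_upper T_DL T_coher \<kappa>rUE (G_bound \<kappa>tBS \<sigma>2_UE p_BS R)) \<and>
         ul_capacity T_UL T_coher M C H H_BS H_UE chan J_BS \<kappa>tUE \<kappa>rBS \<sigma>2_BS p_UE
           \<le> ennreal (capacity_upper T_UL T_coher \<kappa>tUE (G_bound \<kappa>rBS \<sigma>2_BS p_UE R))"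
proof
  note [measurable] = assms(2-5)
  have X: "(\<lambda>\<omega>. chan (H \<omega>)) \<in> borel_measurable M" by measurable
  have triple: "(H \<omega>, H_BS \<omega>, H_UE \<omega>) \<in> space (A \<Otimes>\<^sub>M B \<Otimes>\<^sub>M C)" if "\<omega> \<in> space M" for \<omega>
    using that assms(2-4)[THEN measurable_space] by (simp add: space_pair_measure)
  show "dl_capacity T_DL T_coher M B H H_BS H_UE chan J_UE \<kappa>tBS \<kappa>rUE \<sigma>2_UE p_BS
           \<le> ennreal (capacity_upper T_DL T_coher \<kappa>rUE (G_bound \<kappa>tBS \<sigma>2_UE p_BS R))"
    unfolding dl_capacity_def
  proof (rule capacity_le_capacity_upper[OF assms(1) X assms(8,7)])
    fix \<omega> assume \<omega>: "\<omega> \<in> space M"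
    have J: "prob_space (J_UE (H \<omega>, H_BS \<omega>, H_UE \<omega>))" "sets (J_UE (H \<omega>, H_BS \<omega>, H_UE \<omega>)) = sets borel"
      using measurable_space[OF assms(9) triple[OF \<omega>]] by (simp_all add: space_prob_algebra)
    have K: "H_BS \<omega> \<in> space B" using assms(3) \<omega> by (rule measurable_space)
    show "(SUP f\<in>dl_inputs B p_BS. ennreal (dl_mutual_information \<kappa>tBS \<kappa>rUE \<sigma>2_UE
        (J_UE (H \<omega>, H_BS \<omega>, H_UE \<omega>)) (chan (H \<omega>)) (f (H_BS \<omega>)))) \<le>
      ennreal (log 2 (1 + channel_gain \<kappa>tBS \<sigma>2_UE p_BS (chan (H \<omega>)) /
        (1 + \<kappa>rUE * channel_gain \<kappa>tBS \<sigma>2_UE p_BS (chan (H \<omega>)))))"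
    \<comment> \<open>The bound at a realization does not involve f, so it passes to the
      supremum.\<close>
    proof (rule SUP_least, rule ennreal_leI)
      fix f :: "'b \<Rightarrow> (complex ^ 'n) measure" assume f: "f \<in> dl_inputs B p_BS"
      then have "f (H_BS \<omega>) \<in> space (prob_algebra borel)"
        using K by (auto simp: dl_inputs_def intro: measurable_space)
      then show "dl_mutual_information \<kappa>tBS \<kappa>rUE \<sigma>2_UE (J_UE (H \<omega>, H_BS \<omega>, H_UE \<omega>)) (chan (H \<omega>)) (f (H_BS \<omega>)) \<le>
        log 2 (1 + channel_gain \<kappa>tBS \<sigma>2_UE p_BS (chan (H \<omega>)) / (1 + \<kappa>rUE * channel_gain \<kappa>tBS \<sigma>2_UE p_BS (chan (H \<omega>))))"
        using f K assms by (intro dl_mutual_information_le J) (auto simp: space_prob_algebra dl_inputs_def)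
    qed
  qed (use assms in simp_all)
  show "ul_capacity T_UL T_coher M C H H_BS H_UE chan J_BS \<kappa>tUE \<kappa>rBS \<sigma>2_BS p_UE
           \<le> ennreal (capacity_upper T_UL T_coher \<kappa>tUE (G_bound \<kappa>rBS \<sigma>2_BS p_UE R))"
    unfolding ul_capacity_def
  proof (rule capacity_le_capacity_upper[OF assms(1) X assms(8,7)])
    fix \<omega> assume \<omega>: "\<omega> \<in> space M"
    have J: "prob_space (J_BS (H \<omega>, H_BS \<omega>, H_UE \<omega>))" "sets (J_BS (H \<omega>, H_BS \<omega>, H_UE \<omega>)) = sets borel"
      using measurable_space[OF assms(11) triple[OF \<omega>]] by (simp_all add: space_prob_algebra)
    have L: "H_UE \<omega> \<in> space C" using assms(4) \<omega> by (rule measurable_space)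
    show "(SUP f\<in>ul_inputs C p_UE. ennreal (ul_mutual_information \<kappa>tUE \<kappa>rBS \<sigma>2_BS p_UE
        (J_BS (H \<omega>, H_BS \<omega>, H_UE \<omega>)) (chan (H \<omega>)) (f (H_UE \<omega>)))) \<le>
      ennreal (log 2 (1 + channel_gain \<kappa>rBS \<sigma>2_BS p_UE (chan (H \<omega>)) /
        (1 + \<kappa>tUE * channel_gain \<kappa>rBS \<sigma>2_BS p_UE (chan (H \<omega>)))))"
    proof (rule SUP_least, rule ennreal_leI)
      fix f :: "'c \<Rightarrow> complex measure" assume f: "f \<in> ul_inputs C p_UE"
      then have "f (H_UE \<omega>) \<in> space (prob_algebra borel)"
        using L by (auto simp: ul_inputs_def intro: measurable_space)
      then show "ul_mutual_information \<kappa>tUE \<kappa>rBS \<sigma>2_BS p_UE (J_BS (H \<omega>, H_BS \<omega>, H_UE \<omega>)) (chan (H \<omega>)) (f (H_UE \<omega>)) \<le>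
        log 2 (1 + channel_gain \<kappa>rBS \<sigma>2_BS p_UE (chan (H \<omega>)) / (1 + \<kappa>tUE * channel_gain \<kappa>rBS \<sigma>2_BS p_UE (chan (H \<omega>))))"
        using f L assms by (intro ul_mutual_information_le J) (auto simp: space_prob_algebra ul_inputs_def)
    qed
  qed (use assms in simp_all)
qed

end
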